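(* Let $a=b>0$. Consider each of the following two cases, in which, for every integer $r\ge2$, a loss function $L$ and an estimator $\hat p$ based on inverse binomial sampling with $r$ successes are given: (1) $L(x)=a(1-x)$ for $x\le1$, $L(x)=b(x-1)$ for $x>1$, with estimator $\hat p=(r-1)/(N-1)$; (2) $L(x)=a(1/x-1)$ for $0<x\le1$, $L(x)=b(x-1)$ for $x>1$, with estimator $\hat p=\tilde\Omega/N$, where $\tilde\Omega=\sqrt{r(r-1)}$. In each case let $\bar\eta=\bar\eta(r)$ be the limit as $p\to0$ of the risk of the given estimator (which coincides with the supremum of its risk over $p\in(0,1)$), and let $\eta^*=\eta^*(r)$ be the minimum of $\limsup_{p\to0}\eta(p)$ over all (possibly randomized) estimators. Then in each case the estimator approaches a minimax estimator asymptotically as $r\to\infty$, in the sense that $$\lim_{r\to\infty}\frac{\bar\eta}{\eta^*}=1.$$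
   Context: Inverse binomial sampling: in a sequence of independent Bernoulli trials with success probability $p\in(0,1)$, observations are taken until exactly $r$ successes are obtained; $N$ is the number of observations, so $P[N=n]=\binom{n-1}{r-1}p^r(1-p)^{n-r}$, $n\ge r$. An estimator $\hat p$ is a function $g(N)$ of $N$ or, if randomized, a random variable whose conditional distribution given $N$ does not depend on $p$. The risk of an estimator is $\eta(p)=\mathrm{E}[L(\hat p/p)]$. An estimator is minimax if it minimizes $\sup_{p\in(0,1)}\eta(p)$ over all (possibly randomized) estimators. Background known from earlier work, for both loss functions, $r\ge2$ and $a,b>0$: if $\hat p=g(N)$ with $\lim_{n\to\infty}n\,g(n)=\Omega>0$, then $\lim_{p\to0}\eta(p)=\frac{1}{(r-1)!}\int_0^\infty \nu^{r-1}e^{-\nu}L(\Omega/\nu)\,d\nu$; and there is a value $\Omega^*>0$ such that any estimator $\hat p=g(N)$ with $\lim_{n\to\infty} n\,g(n)=\Omega^*$ attains the minimum $\eta^*$ of $\limsup_{p\to0}\eta(p)$ over all estimators, including randomized ones. Thus $\eta^*=\min_{\Omega>0}\frac{1}{(r-1)!}\int_0^\infty \nu^{r-1}e^{-\nu}L(\Omega/\nu)\,d\nu$. *)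

theory Defs
  imports "HOL-Probability.Probability"
begin

text \<open>
  \<^const>\<open>neg_binomial_pmf\<close> counts the failures before the \<open>r\<close>-th success, so the number
  of observations is obtained by adding the \<open>r\<close> successes.
\<close>

definition inverse_binomial_pmf :: "nat \<Rightarrow> real \<Rightarrow> nat pmf" where
  "inverse_binomial_pmf r p = map_pmf (\<lambda>k. k + r) (neg_binomial_pmf r p)"

lemma pmf_inverse_binomial:
  assumes "p \<in> {0<..1}" "1 \<le> r" "r \<le> n"
  shows "pmf (inverse_binomial_pmf r p) n = real ((n - 1) choose (r - 1)) * p ^ r * (1 - p) ^ (n - r)"
proof -
  have "pmf (inverse_binomial_pmf r p) (n - r + r) = pmf (neg_binomial_pmf r p) (n - r)"
    unfolding inverse_binomial_pmf_def by (rule pmf_map_inj') (simp add: inj_on_def)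
  moreover have "(n - 1) choose (n - r) = (n - 1) choose (r - 1)"
    using binomial_symmetric[of "r - 1" "n - 1"] assms by simp
  ultimately show ?thesis
    using assms by (simp add: pmf_neg_binomial)
qed

text \<open>
  A (possibly randomized) estimator is given by the conditional distributions \<open>K n\<close> of the
  estimate given \<open>N = n\<close>; these do not depend on \<open>p\<close>. The estimator \<open>g(N)\<close> has
  point masses as conditional distributions.
\<close>

definition estimators :: "(nat \<Rightarrow> real measure) set" where
  "estimators = measurable (count_space UNIV) (prob_algebra borel)"

definition nonrandomized :: "(nat \<Rightarrow> real) \<Rightarrow> nat \<Rightarrow> real measure" where
  "nonrandomized g n = return borel (g n)"

lemma nonrandomized_in_estimators: "nonrandomized g \<in> estimators"
  by (auto simp: estimators_def nonrandomized_def space_prob_algebra prob_space_return)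

text \<open>
  The integrating measure below is the unconditional distribution of the estimate. The risk takes
  values in \<^typ>\<open>ennreal\<close>, because estimators of infinite risk are not excluded.
\<close>

definition risk :: "(real \<Rightarrow> ennreal) \<Rightarrow> nat \<Rightarrow> (nat \<Rightarrow> real measure) \<Rightarrow> real \<Rightarrow> ennreal" where
  "risk L r K p = (\<integral>\<^sup>+ x. L (x / p) \<partial>(measure_pmf (inverse_binomial_pmf r p) \<bind> K))"

definition asymptotic_risk :: "(real \<Rightarrow> ennreal) \<Rightarrow> nat \<Rightarrow> (nat \<Rightarrow> real measure) \<Rightarrow> ennreal" where
  "asymptotic_risk L r K = Limsup (at_right 0) (risk L r K)"

definition loss_linear :: "real \<Rightarrow> real \<Rightarrow> real \<Rightarrow> ennreal" where
  "loss_linear a b x = ennreal (if x \<le> 1 then a * (1 - x) else b * (x - 1))"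

text \<open>
  The second loss is a function on the positive reals, tending to infinity at 0. The value \<open>\<infinity>\<close>
  elsewhere excludes estimates that fail to be positive.
\<close>

definition loss_inverse_linear :: "real \<Rightarrow> real \<Rightarrow> real \<Rightarrow> ennreal" where
  "loss_inverse_linear a b x =
     (if x \<le> 0 then \<infinity> else ennreal (if x \<le> 1 then a * (1 / x - 1) else b * (x - 1)))"

end

theory Submission
  imports Defs "HOL-Real_Asymp.Real_Asymp"
begin

text \<open>
  Write \<open>G\<close> for a gamma variable of shape \<open>r\<close> and \<open>H(W) = E L(W/G)\<close> for the limiting risk of
  \<open>W/N\<close>. Each observation corresponds to an exponential waiting time of mean \<open>p\<close>, and
  a geometric number of these sums to a standard exponential; hence \<open>G\<close> can be realised with
  \<open>E(G | N) = p N\<close> and \<open>Var(G | N) = p\<^sup>2 N\<close>. For the convex functions \<open>f\<close> at hand, Jensen's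
  inequality yields \<open>E f(p N) \<le> E f(G)\<close> for every \<open>p\<close>, and the small variance yields convergence
  as \<open>p \<rightarrow> 0\<close>; so the limit of the risk is also its supremum.

  That no randomized estimator has an asymptotic risk below \<open>min H\<close> follows by averaging the risk
  over the prior \<open>dp/p\<close> on \<open>[\<delta>, \<epsilon>]\<close>: up to edge effects each \<open>n\<close> between \<open>1/\<epsilon>\<close> and \<open>1/\<delta>\<close> contributes
  at least \<open>min H / n\<close>, and the sum of these is asymptotic to \<open>min H \<cdot> ln (\<epsilon>/\<delta>)\<close>.

  Finally, the median of a gamma distribution lies between its mode and its mean, which are one
  unit apart. By convexity of \<open>H\<close> this locates its minimiser within a bounded distance of
  \<open>r - 1\<close>, respectively \<open>\<surd>(r (r - 1))\<close>, so the limiting risk of the given estimator exceeds \<open>min H\<close> by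
  \<open>O(1/r)\<close> only, whereas it is itself at least of the order \<open>1/\<surd>r\<close>.
\<close>

section \<open>The gamma limit of inverse binomial sampling\<close>

text \<open>\<^const>\<open>erlang_density\<close> with first argument \<open>k\<close> has shape \<open>k + 1\<close>; so \<open>r\<close> successes correspond to
  \<open>k = r - 1\<close>.\<close>

definition erlang_mean :: "nat \<Rightarrow> (real \<Rightarrow> ennreal) \<Rightarrow> ennreal" where
  "erlang_mean k f = (\<integral>\<^sup>+ v. ennreal (erlang_density k 1 v) * f v \<partial>lborel)"

section \<open>The gamma law as a mixture over the number of observations\<close>

lemma nn_integral_inverse_binomial:
  assumes "p \<in> {0<..1}"
  shows "(\<integral>\<^sup>+ n. f n \<partial>measure_pmf (inverse_binomial_pmf (Suc k) p)) =
    (\<Sum>j. ennreal (real ((j + k) choose k) * p ^ Suc k * (1 - p) ^ j) * f (j + Suc k))"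
proof -
  have "(j + k) choose j = (j + k) choose k" for j
    using binomial_symmetric[of j "j + k"] by simp
  then show ?thesis
    using assms unfolding inverse_binomial_pmf_def nn_integral_map_pmf
    by (simp add: nn_integral_measure_pmf nn_integral_count_space_nat pmf_neg_binomial del: power_Suc)
qed

text \<open>Given \<open>N = n\<close>, the gamma variable is a sum of \<open>n\<close> exponentials
  of mean \<open>p\<close>. Once the factorials cancel, the series in \<open>j\<close> is that of
  \<open>exp ((1 - p) * v / p)\<close>, which turns \<open>exp (- v / p)\<close> into
  \<open>exp (- v)\<close>.\<close>

lemma erlang_density_mixture_sums:
  assumes p: "p \<in> {0<..1}"
  shows "(\<lambda>j. real ((j + k) choose k) * p ^ Suc k * (1 - p) ^ j * erlang_density (j + k) (1 / p) v)
    sums erlang_density k 1 v"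
proof (cases "v < 0")
  case False
  have *: "real ((j + k) choose k) * p ^ Suc k * (1 - p) ^ j * erlang_density (j + k) (1 / p) v =
     v ^ k * exp (- v / p) / fact k * (((1 - p) * v / p) ^ j /\<^sub>R fact j)" for j
  proof -
    define q where "q = 1 - p"
    have "real ((j + k) choose k) = fact (j + k) / (fact k * fact j)"
      by (subst binomial_fact) auto
    then show ?thesis
      using p False unfolding q_def[symmetric]
      by (simp add: erlang_density_def divide_simps power_add power_mult_distrib)
  qed
  have "(\<lambda>j. v ^ k * exp (- v / p) / fact k * (((1 - p) * v / p) ^ j /\<^sub>R fact j)) sums
     (v ^ k * exp (- v / p) / fact k * exp ((1 - p) * v / p))"
    by (intro sums_mult exp_converges)
  also have "v ^ k * exp (- v / p) / fact k * exp ((1 - p) * v / p) = erlang_density k 1 v"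
  proof -
    have "- v / p + (1 - p) * v / p = - v" using p by (simp add: field_simps)
    then have "exp (- v / p) * exp ((1 - p) * v / p) = exp (- v)"
      by (metis exp_add)
    then show ?thesis using False by (simp add: erlang_density_def)
  qed
  finally show ?thesis unfolding * .
qed (simp add: erlang_density_def)

lemma erlang_mean_mixture:
  assumes p: "p \<in> {0<..1}" and [measurable]: "f \<in> borel_measurable borel"
  shows "erlang_mean k f =
    (\<integral>\<^sup>+ n. (\<integral>\<^sup>+ v. ennreal (erlang_density (n - 1) (1 / p) v) * f v \<partial>lborel)
      \<partial>measure_pmf (inverse_binomial_pmf (Suc k) p))"
proof -
  let ?w = "\<lambda>j. real ((j + k) choose k) * p ^ Suc k * (1 - p) ^ j"
  have w: "0 \<le> ?w j" for j using p by simp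
  have "ennreal (erlang_density k 1 v) = (\<Sum>j. ennreal (?w j * erlang_density (j + k) (1 / p) v))" for v
    using erlang_density_mixture_sums[OF p, of k v] w p
    by (intro suminf_ennreal_eq[symmetric]) (auto intro!: mult_nonneg_nonneg)
  then have "erlang_mean k f =
     (\<integral>\<^sup>+ v. (\<Sum>j. ennreal (?w j) * (ennreal (erlang_density (j + k) (1 / p) v) * f v)) \<partial>lborel)"
    unfolding erlang_mean_def using w p
    by (intro nn_integral_cong) (simp add: ennreal_mult mult.assoc del: power_Suc flip: ennreal_suminf_multc)
  also have "\<dots> = (\<Sum>j. ennreal (?w j) * (\<integral>\<^sup>+ v. ennreal (erlang_density (j + k) (1 / p) v) * f v \<partial>lborel))"
    by (simp add: nn_integral_suminf nn_integral_cmult del: power_Suc)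
  finally show ?thesis
    using p by (simp add: nn_integral_inverse_binomial)
qed

lemma fact_add_2: "fact (m + 2) = ((real m + 1) * (real m + 2)) * (fact m :: real)"
  by (simp add: numeral_2_eq_2 algebra_simps)

lemma nn_integral_erlang_mean:
  assumes "p \<in> {0<..1}" "0 < n"
  shows "(\<integral>\<^sup>+ v. ennreal (erlang_density (n - 1) (1 / p) v) * ennreal v \<partial>lborel) = ennreal (p * real n)"
proof -
  have "(\<integral>\<^sup>+ v. ennreal (erlang_density (n - 1) (1 / p) v) * ennreal v \<partial>lborel) =
     (\<integral>\<^sup>+ v. ennreal (erlang_density (n - 1) (1 / p) v * v ^ 1) \<partial>lborel)"
    using assms by (intro nn_integral_cong) (auto simp: erlang_density_def ennreal_mult' ennreal_neg)
  then show ?thesis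
    using assms nn_integral_erlang_ith_moment[of "1 / p" "n - 1" 1]
    by (cases n) (auto simp: mult.commute simp del: of_nat_Suc)
qed

text \<open>Follows from the mixture with \<open>f = ennreal\<close>: the conditional mean is
  \<open>p * n\<close>, the unconditional one is that of the gamma law.\<close>

lemma mean_inverse_binomial:
  assumes p: "p \<in> {0<..1}"
  shows "(\<integral>\<^sup>+ n. ennreal (p * real n) \<partial>measure_pmf (inverse_binomial_pmf (Suc k) p)) = ennreal (real (Suc k))"
proof -
  have "erlang_mean k ennreal = (\<integral>\<^sup>+ v. ennreal (erlang_density k 1 v * v ^ 1) \<partial>lborel)"
    unfolding erlang_mean_def
    by (intro nn_integral_cong) (auto simp: erlang_density_def ennreal_mult' ennreal_neg)
  then have "erlang_mean k ennreal = ennreal (real (Suc k))"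
    using nn_integral_erlang_ith_moment[of 1 k 1] by (simp del: of_nat_Suc)
  then show ?thesis
    using erlang_mean_mixture[OF p, of ennreal k] p
    by (simp add: nn_integral_inverse_binomial nn_integral_erlang_mean[of p "Suc (_ + _)", simplified])
qed

lemma erlang_integrals:
  assumes "p \<in> {0<..1}" "0 < n"
  defines "M \<equiv> density lborel (erlang_density (n - 1) (1 / p))"
  shows "prob_space M" "AE v in M. 0 < v" "integrable M (\<lambda>v. v)" "(\<integral>v. v \<partial>M) = p * real n"
    "integrable M (\<lambda>v. v\<^sup>2)" "(\<integral>v. v\<^sup>2 \<partial>M) = p\<^sup>2 * real n * (real n + 1)"
proof -
  show ps: "prob_space M" unfolding M_def using assms by (intro prob_space_erlang_density) auto
  have "AE v in lborel. v \<noteq> (0::real)" by (rule AE_lborel_singleton)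
  then show "AE v in M. 0 < v"
    unfolding M_def by (subst AE_density) (auto simp: erlang_density_def elim!: AE_mp)
  have D: "distributed M lborel (\<lambda>x. x) (erlang_density (n - 1) (1 / p))"
    unfolding distributed_def M_def
    by (auto simp: distr_id2)
  have 1: "has_bochner_integral M (\<lambda>v. v ^ i) (fact (n - 1 + i) / (fact (n - 1) * (1 / p) ^ i))" for i
    using assms prob_space.has_bochner_integral_erlang_ith_moment[OF ps _ D] by simp
  obtain m where m: "n = Suc m" using assms by (cases n) auto
  have "fact (n - 1 + 1) / (fact (n - 1) * (1 / p) ^ 1) = p * real n"
    using assms(1) by (simp add: m del: of_nat_Suc)
  then have "has_bochner_integral M (\<lambda>v. v) (p * real n)" using 1[of 1] by (simp only: power_one_right)
  then show "integrable M (\<lambda>v. v)" "(\<integral>v. v \<partial>M) = p * real n"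
    by (simp_all only: has_bochner_integral_iff)
  have "fact (n - 1 + 2) / (fact (n - 1) * (1 / p) ^ 2) = p\<^sup>2 * real n * (real n + 1)"
  proof -
    have "A * fact m / (fact m * (1 / p) ^ 2) = p\<^sup>2 * A" for A :: real
      using assms(1) by (simp add: power_divide)
    moreover have "real n * (real n + 1) = (real m + 1) * (real m + 2)" by (simp add: m algebra_simps)
    ultimately show ?thesis unfolding mult.assoc m diff_Suc_1 fact_add_2[of m] by auto
  qed
  then have "has_bochner_integral M (\<lambda>v. v\<^sup>2) (p\<^sup>2 * real n * (real n + 1))" using 1[of 2] by simp
  then show "integrable M (\<lambda>v. v\<^sup>2)" "(\<integral>v. v\<^sup>2 \<partial>M) = p\<^sup>2 * real n * (real n + 1)"
    by (simp_all only: has_bochner_integral_iff)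
qed

section \<open>Comparing expectations of \<open>p * N\<close> and of the gamma variable\<close>

lemma erlang_jensen:
  fixes f :: "real \<Rightarrow> real"
  assumes p: "p \<in> {0<..1}" "0 < n" and [measurable]: "f \<in> borel_measurable borel"
    and f: "convex_on {0<..} f" "\<And>v. 0 < v \<Longrightarrow> 0 \<le> f v"
  shows "ennreal (f (p * real n)) \<le>
    (\<integral>\<^sup>+ v. ennreal (erlang_density (n - 1) (1 / p) v) * ennreal (f v) \<partial>lborel)"
proof -
  define M where "M = density lborel (erlang_density (n - 1) (1 / p))"
  note M = erlang_integrals[OF p, folded M_def]
  have ps: "prob_space M" using M by simp
  have [measurable_cong, simp]: "sets M = sets borel" by (simp add: M_def)
  have eq: "(\<integral>\<^sup>+ v. ennreal (erlang_density (n - 1) (1 / p) v) * ennreal (f v) \<partial>lborel) = (\<integral>\<^sup>+ v. ennreal (f v) \<partial>M)"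
    unfolding M_def by (subst nn_integral_density) auto
  have nn: "AE v in M. 0 \<le> f v"
    using M(2) by eventually_elim (use f in auto)
  show ?thesis
  proof (cases "integrable M f")
    case True
    have "f (\<integral>v. v \<partial>M) \<le> (\<integral>v. f v \<partial>M)"
    proof (rule prob_space.jensens_inequality[OF ps M(3)])
      show "AE v in M. v \<in> {0<..}" using M(2) by eventually_elim simp
      show "{0<..} = {0::real<..<0} \<or> {0<..} = {0::real<..} \<or> {0<..} = {..<0::real} \<or> {0<..} = (UNIV :: real set)"
        by (intro disjI2 disjI1 refl)
      show "integrable M (\<lambda>v. f v)" by (rule True)
    qed (rule f(1))
    then show ?thesis
      unfolding eq nn_integral_eq_integral[OF True nn] M(4) by (rule ennreal_leI)
  next
    \<comment> \<open>As \<open>f\<close> is nonnegative almost everywhere under \<open>M\<close>,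
      failure of integrability can only mean that the right-hand side is infinite.\<close>
    case False
    have "f \<in> borel_measurable M" by measurable
    then have "\<not> (\<integral>\<^sup>+ v. ennreal (f v) \<partial>M) < \<infinity>"
      using False nn by (blast intro: integrableI_nonneg)
    then have "(\<integral>\<^sup>+ v. ennreal (f v) \<partial>M) = top"
      by (simp add: not_less top_unique)
    then show ?thesis unfolding eq by simp
  qed
qed

text \<open>Jensen's inequality is applied conditionally on \<open>N\<close>, where the gamma
  variable has mean \<open>p * N\<close>, and the results are averaged with the weights of the
  mixture.\<close>

lemma inverse_binomial_le_erlang_mean:
  fixes f :: "real \<Rightarrow> real"
  assumes p: "p \<in> {0<..1}" and [measurable]: "f \<in> borel_measurable borel"
    and f: "convex_on {0<..} f" "\<And>v. 0 < v \<Longrightarrow> 0 \<le> f v"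
  shows "(\<integral>\<^sup>+ n. ennreal (f (p * real n)) \<partial>measure_pmf (inverse_binomial_pmf (Suc k) p)) \<le>
    erlang_mean k (\<lambda>v. ennreal (f v))"
  unfolding erlang_mean_mixture[OF p measurable_compose[OF assms(2) measurable_ennreal]]
    nn_integral_inverse_binomial[OF p]
  using erlang_jensen[OF p _ assms(2) f, of "Suc (_ + k)"]
  by (intro suminf_le mult_left_mono) (auto simp: add.commute)

text \<open>A converse of Jensen's inequality with an explicit error. The conditional variance is
  \<open>p\<^sup>2 * n\<close>; \<open>e\<close> is left free to balance the two error
  terms.\<close>

lemma erlang_lipschitz:
  fixes f :: "real \<Rightarrow> real"
  assumes p: "p \<in> {0<..1}" "0 < n" and [measurable]: "f \<in> borel_measurable borel" and "0 < e"
    and f: "C-lipschitz_on {0<..} f" "\<And>v. 0 < v \<Longrightarrow> 0 \<le> f v"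
  shows "(\<integral>\<^sup>+ v. ennreal (erlang_density (n - 1) (1 / p) v) * ennreal (f v) \<partial>lborel) \<le>
    ennreal (f (p * real n)) + ennreal (C * (e + p\<^sup>2 * real n / e))"
proof -
  define M where "M = density lborel (erlang_density (n - 1) (1 / p))"
  note M = erlang_integrals[OF p, folded M_def]
  interpret prob_space M by fact
  have [measurable_cong, simp]: "sets M = sets borel" by (simp add: M_def)
  have C: "0 \<le> C" using f(1) by (rule lipschitz_on_nonneg)
  let ?m = "p * real n"
  let ?g = "\<lambda>v. f ?m + C * (e + (v\<^sup>2 - 2 * ?m * v + ?m\<^sup>2) / e)"
  have int: "integrable M ?g"
    using M by (auto intro!: Bochner_Integration.integrable_add integrable_mult_right
        integrable_divide Bochner_Integration.integrable_diff)
  have bd: "f v \<le> ?g v" if "0 < v" for v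
  proof -
    have "f v - f ?m \<le> C * \<bar>v - ?m\<bar>"
      using lipschitz_onD[OF f(1), of v ?m] that p by (auto simp: dist_real_def)
    \<comment> \<open>The absolute deviation is majorised by a quadratic, so the first two moments
      suffice for the integral.\<close>
    also have "\<bar>v - ?m\<bar> \<le> e + (v - ?m)\<^sup>2 / e"
    proof -
      have "0 \<le> (\<bar>v - ?m\<bar> - e)\<^sup>2 + \<bar>v - ?m\<bar> * e" using \<open>0 < e\<close> by simp
      then have "e * \<bar>v - ?m\<bar> \<le> e * e + \<bar>v - ?m\<bar>\<^sup>2" by (simp add: power2_eq_square algebra_simps)
      then show ?thesis using \<open>0 < e\<close> by (simp add: field_simps)
    qed
    finally have "f v - f ?m \<le> C * (e + (v - ?m)\<^sup>2 / e)" using C by (simp add: mult_left_mono)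
    moreover have "(v - ?m)\<^sup>2 = v\<^sup>2 - 2 * ?m * v + ?m\<^sup>2" by (simp add: power2_eq_square algebra_simps)
    ultimately show ?thesis by simp
  qed
  have "(\<integral>\<^sup>+ v. ennreal (erlang_density (n - 1) (1 / p) v) * ennreal (f v) \<partial>lborel) = (\<integral>\<^sup>+ v. ennreal (f v) \<partial>M)"
    unfolding M_def by (subst nn_integral_density) auto
  also have "\<dots> \<le> (\<integral>\<^sup>+ v. ennreal (?g v) \<partial>M)"
    using M(2) by (intro nn_integral_mono_AE) (auto elim!: eventually_mono intro!: ennreal_leI bd)
  also have "\<dots> = ennreal (\<integral>v. ?g v \<partial>M)"
    using M(2) f(2) bd by (intro nn_integral_eq_integral int) (force elim!: eventually_mono)
  also have "(\<integral>v. ?g v \<partial>M) = f ?m + C * (e + ((\<integral>v. v\<^sup>2 \<partial>M) - 2 * ?m * (\<integral>v. v \<partial>M) + ?m\<^sup>2) / e)"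
    using M by (simp add: prob_space)
  also have "\<dots> = f ?m + C * (e + p\<^sup>2 * real n / e)"
    unfolding M(4,6) by (simp add: power2_eq_square algebra_simps)
  also have "ennreal \<dots> = ennreal (f ?m) + ennreal (C * (e + p\<^sup>2 * real n / e))"
    using C \<open>0 < e\<close> p f(2)[of ?m] by (intro ennreal_plus) auto
  finally show ?thesis .
qed

lemma erlang_mean_le_inverse_binomial:
  fixes f :: "real \<Rightarrow> real"
  assumes p: "p \<in> {0<..1}" and [measurable]: "f \<in> borel_measurable borel"
    and f: "C-lipschitz_on {0<..} f" "\<And>v. 0 < v \<Longrightarrow> 0 \<le> f v"
  shows "erlang_mean k (\<lambda>v. ennreal (f v)) \<le>
    (\<integral>\<^sup>+ n. ennreal (f (p * real n)) \<partial>measure_pmf (inverse_binomial_pmf (Suc k) p)) +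
    ennreal (C * (real k + 2) * sqrt p)"
proof -
  let ?M = "measure_pmf (inverse_binomial_pmf (Suc k) p)"
  have C: "0 \<le> C" using f(1) by (rule lipschitz_on_nonneg)
  have ae: "AE n in ?M. 0 < n"
    by (auto simp: AE_measure_pmf_iff inverse_binomial_pmf_def)
  have "erlang_mean k (\<lambda>v. ennreal (f v)) \<le>
    (\<integral>\<^sup>+ n. ennreal (f (p * real n)) + (ennreal (C * sqrt p) + ennreal (C * sqrt p) * ennreal (p * real n)) \<partial>?M)"
    unfolding erlang_mean_mixture[OF p measurable_compose[OF assms(2) measurable_ennreal]]
  proof (intro nn_integral_mono_AE, use ae in eventually_elim)
    case (elim n)
    have "(\<integral>\<^sup>+ v. ennreal (erlang_density (n - 1) (1 / p) v) * ennreal (f v) \<partial>lborel) \<le>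
       ennreal (f (p * real n)) + ennreal (C * (sqrt p + p\<^sup>2 * real n / sqrt p))"
      \<comment> \<open>The choice \<open>e = sqrt p\<close> gives both error terms the order
        \<open>sqrt p\<close>, the second one times \<open>p * n\<close>, whose mean is
        \<open>k + 1\<close>.\<close>
      using p elim f by (intro erlang_lipschitz) auto
    also have "C * (sqrt p + p\<^sup>2 * real n / sqrt p) = C * sqrt p + C * sqrt p * (p * real n)"
      using p by (simp add: field_simps power2_eq_square)
    also have "ennreal \<dots> = ennreal (C * sqrt p) + ennreal (C * sqrt p) * ennreal (p * real n)"
      using C p by (subst ennreal_plus) (simp_all add: ennreal_mult)
    finally show ?case .
  qed
  also have "\<dots> = (\<integral>\<^sup>+ n. ennreal (f (p * real n)) \<partial>?M) +
      (ennreal (C * sqrt p) + ennreal (C * sqrt p) * ennreal (real (Suc k)))"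
    using mean_inverse_binomial[OF p, of k]
    by (simp add: nn_integral_add nn_integral_cmult measure_pmf.emeasure_space_1)
  also have "ennreal (C * sqrt p) + ennreal (C * sqrt p) * ennreal (real (Suc k)) =
      ennreal (C * (real k + 2) * sqrt p)"
    using C p by (simp add: algebra_simps flip: ennreal_mult ennreal_plus)
  finally show ?thesis .
qed

text \<open>Jensen's inequality bounds the upper limit at every \<open>p\<close>. The converse is at
  hand for Lipschitz functions, whereas the second loss makes \<open>f\<close> blow up at 0; so
  \<open>f\<close> is approached from below by Lipschitz functions \<open>g i\<close>, with monotone
  convergence on the gamma side.\<close>

lemma inverse_binomial_tendsto_erlang_mean:
  fixes f :: "real \<Rightarrow> real" and g :: "nat \<Rightarrow> real \<Rightarrow> real"
  assumes [measurable]: "f \<in> borel_measurable borel" "\<And>i. g i \<in> borel_measurable borel"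
    and f: "convex_on {0<..} f" "\<And>v. 0 < v \<Longrightarrow> 0 \<le> f v"
    and g: "\<And>i. \<exists>C. C-lipschitz_on {0<..} (g i)" "\<And>i v. 0 < v \<Longrightarrow> 0 \<le> g i v"
      "\<And>i v. 0 < v \<Longrightarrow> g i v \<le> f v" "\<And>v. 0 < v \<Longrightarrow> incseq (\<lambda>i. g i v)"
      "\<And>v. 0 < v \<Longrightarrow> (\<lambda>i. g i v) \<longlonglongrightarrow> f v"
  shows "((\<lambda>p. \<integral>\<^sup>+ n. ennreal (f (p * real n)) \<partial>measure_pmf (inverse_binomial_pmf (Suc k) p))
    \<longlongrightarrow> erlang_mean k (\<lambda>v. ennreal (f v))) (at_right 0)" (is "(?R \<longlongrightarrow> ?m) _")
proof (rule order_tendstoI)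
  fix a assume a: "a > ?m"
  have "\<forall>\<^sub>F p in at_right (0::real). p \<in> {0<..<1}"
    by (rule eventually_at_right_real) simp
  then show "\<forall>\<^sub>F p in at_right 0. ?R p < a"
  proof eventually_elim
    case (elim p)
    then have "?R p \<le> ?m" using inverse_binomial_le_erlang_mean[OF _ _ f] by simp
    then show ?case using a by simp
  qed
next
  fix a assume a: "a < ?m"
  \<comment> \<open>The hypotheses on \<open>g\<close> concern positive arguments, so the integrand
    is cut off to these before monotone convergence is applied.\<close>
  have "?m = (\<integral>\<^sup>+ v. (SUP i. ennreal (erlang_density k 1 v) * ennreal (g i v) * indicator {0<..} v) \<partial>lborel)"
    unfolding erlang_mean_def
  proof (intro nn_integral_cong_AE, use AE_lborel_singleton[of "0::real"] in eventually_elim)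
    case (elim v)
    show ?case
    proof (cases "0 < v")
      case True
      have "(\<lambda>i. ennreal (g i v)) \<longlonglongrightarrow> ennreal (f v)" using g(5)[OF True] by simp
      moreover have "incseq (\<lambda>i. ennreal (g i v))" using g(4)[OF True] by (auto simp: incseq_def intro!: ennreal_leI)
      ultimately have "(SUP i. ennreal (g i v)) = ennreal (f v)"
        using LIMSEQ_SUP LIMSEQ_unique by blast
      then show ?thesis using True by (simp flip: SUP_mult_left_ennreal)
    qed (use elim in \<open>auto simp: erlang_density_def\<close>)
  qed
  also have "\<dots> = (SUP i. (\<integral>\<^sup>+ v. ennreal (erlang_density k 1 v) * ennreal (g i v) * indicator {0<..} v \<partial>lborel))"
  proof (intro nn_integral_monotone_convergence_SUP)
    show "incseq (\<lambda>i v. ennreal (erlang_density k 1 v) * ennreal (g i v) * indicator {0<..} v)"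
      using g(4) by (auto simp: incseq_def le_fun_def split: split_indicator intro!: mult_left_mono ennreal_leI)
  qed auto
  also have "\<dots> \<le> (SUP i. erlang_mean k (\<lambda>v. ennreal (g i v)))"
    unfolding erlang_mean_def by (intro SUP_mono' nn_integral_mono) (auto split: split_indicator)
  finally have "a < (SUP i. erlang_mean k (\<lambda>v. ennreal (g i v)))"
    using a by (rule order.strict_trans2[rotated])
  then obtain i where i: "a < erlang_mean k (\<lambda>v. ennreal (g i v))"
    unfolding less_SUP_iff by blast
  obtain C where C: "C-lipschitz_on {0<..} (g i)" using g(1) by blast
  have "((\<lambda>p. ennreal (C * (real k + 2) * sqrt p)) \<longlongrightarrow> ennreal (C * (real k + 2) * sqrt 0)) (at_right 0)"
    by (intro tendsto_intros)
  then have "((\<lambda>p. a + ennreal (C * (real k + 2) * sqrt p)) \<longlongrightarrow> a + ennreal (C * (real k + 2) * sqrt 0)) (at_right 0)"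
    by (intro tendsto_intros)
  then have "\<forall>\<^sub>F p in at_right 0. a + ennreal (C * (real k + 2) * sqrt p) < erlang_mean k (\<lambda>v. ennreal (g i v))"
    using i by (intro order_tendstoD) simp_all
  moreover have "\<forall>\<^sub>F p in at_right (0::real). p \<in> {0<..<1}"
    by (rule eventually_at_right_real) simp
  ultimately show "\<forall>\<^sub>F p in at_right 0. a < ?R p"
  proof eventually_elim
    case (elim p)
    have "a + ennreal (C * (real k + 2) * sqrt p) <
      (\<integral>\<^sup>+ n. ennreal (g i (p * real n)) \<partial>measure_pmf (inverse_binomial_pmf (Suc k) p)) + ennreal (C * (real k + 2) * sqrt p)"
      using elim erlang_mean_le_inverse_binomial[OF _ _ C g(2)] by (intro order.strict_trans2[OF elim(1)]) auto
    then have "a < (\<integral>\<^sup>+ n. ennreal (g i (p * real n)) \<partial>measure_pmf (inverse_binomial_pmf (Suc k) p))"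
      by (metis add_right_mono not_le)
    also have "\<dots> \<le> ?R p"
      using elim g(3)
      by (intro nn_integral_mono_AE) (auto simp: AE_measure_pmf_iff inverse_binomial_pmf_def intro!: ennreal_leI)
    finally show ?case .
  qed
qed

section \<open>The Bayes lower bound\<close>

lemma nn_integral_risk:
  assumes [measurable]: "L \<in> borel_measurable borel" and K: "K \<in> estimators"
  shows "risk L r K p = (\<integral>\<^sup>+ n. (\<integral>\<^sup>+ x. L (x / p) \<partial>K n) \<partial>measure_pmf (inverse_binomial_pmf r p))"
proof -
  have "K \<in> measurable (measure_pmf (inverse_binomial_pmf r p)) (subprob_algebra borel)"
    using measurable_prob_algebraD[OF K[unfolded estimators_def]] by simp
  then show ?thesis
    unfolding risk_def by (subst nn_integral_bind[where B=borel]) auto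
qed

lemma risk_nonrandomized:
  assumes [measurable]: "L \<in> borel_measurable borel"
  shows "risk L r (nonrandomized g) p = (\<integral>\<^sup>+ n. L (g n / p) \<partial>measure_pmf (inverse_binomial_pmf r p))"
  unfolding nn_integral_risk[OF assms nonrandomized_in_estimators]
  by (simp add: nonrandomized_def nn_integral_return)

section \<open>Lower bounds for the likelihood\<close>

text \<open>The coefficient is the product of \<open>j + 1\<close> up to \<open>j + k\<close>
  divided by \<open>fact k\<close>, and none of these \<open>k\<close> factors is below
  \<open>j + 1\<close>.\<close>

lemma binomial_ge_power_div_fact: "(real j + 1) ^ k / fact k \<le> real ((j + k) choose k)"
proof (induction k)
  case (Suc k)
  have "real (Suc k) * real ((j + Suc k) choose Suc k) = real (Suc (j + k)) * real ((j + k) choose k)"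
    using Suc_times_binomial_eq[of "j + k" k] by (metis add_Suc_right mult.commute of_nat_mult)
  moreover have "(real j + 1) * ((real j + 1) ^ k / fact k) \<le> real (Suc (j + k)) * real ((j + k) choose k)"
    using Suc by (intro mult_mono) auto
  ultimately have "(real j + 1) * ((real j + 1) ^ k / fact k) \<le> real (Suc k) * real ((j + Suc k) choose Suc k)"
    by simp
  then have "(real j + 1) * (real j + 1) ^ k / fact k / real (Suc k) \<le> real ((j + Suc k) choose Suc k)"
    by (simp only: pos_divide_le_eq of_nat_0_less_iff zero_less_Suc mult.commute times_divide_eq_right)
  then show ?case by (simp add: mult.commute divide_divide_eq_left del: of_nat_Suc binomial_Suc_Suc)
qed simp

text \<open>The reciprocal \<open>1 / (1 - p) = 1 + p / (1 - p)\<close> is at most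
  \<open>1 + p / (1 - e)\<close>, hence at most an exponential. Passing from \<open>j\<close> to
  \<open>n\<close> makes the exponent depend on the number of observations.\<close>

lemma one_minus_power_ge_exp:
  fixes p e :: real
  assumes "0 < p" "p \<le> e" "e < 1" "j \<le> n"
  shows "exp (- (real n / (1 - e) * p)) \<le> (1 - p) ^ j"
proof -
  have "1 / (1 - p) \<le> exp (p / (1 - e))"
  proof -
    have "1 / (1 - p) = 1 + p / (1 - p)" using assms by (simp add: field_simps)
    also have "\<dots> \<le> 1 + p / (1 - e)" using assms by (simp add: frac_le)
    also have "\<dots> \<le> exp (p / (1 - e))" by (rule exp_ge_add_one_self)
    finally show ?thesis .
  qed
  then have "exp (- (p / (1 - e))) \<le> 1 - p"
    using assms by (simp add: exp_minus field_simps)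
  then have "exp (- (p / (1 - e))) ^ n \<le> (1 - p) ^ n"
    by (intro power_mono) auto
  also have "\<dots> \<le> (1 - p) ^ j" using assms by (intro power_decreasing) auto
  also have "exp (- (p / (1 - e))) ^ n = exp (- (real n / (1 - e) * p))"
    by (simp flip: exp_of_nat_mult)
  finally show ?thesis .
qed

lemma ln_le_sum_inverse:
  fixes c :: real
  assumes "0 < c"
  shows "ln (c + real m) - ln c \<le> (\<Sum>j<m. 1 / (c + real j))"
proof (induction m)
  case (Suc m)
  have "ln (c + real (Suc m)) - ln (c + real m) = ln ((c + real (Suc m)) / (c + real m))"
    using assms by (simp add: ln_div)
  also have "(c + real (Suc m)) / (c + real m) = 1 + 1 / (c + real m)"
    using assms by (simp add: field_simps)
  also have "ln (1 + 1 / (c + real m)) \<le> 1 / (c + real m)" using assms by (intro ln_add_one_self_le_self) simp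
  finally show ?case using Suc by simp
qed simp

text \<open>For fixed \<open>n\<close>, prior density times likelihood is viewed as a function of
  \<open>p\<close>: it dominates a gamma density of scale \<open>1 / l\<close> times nearly
  \<open>1 / n\<close>. The powers of \<open>1 - real k / real n\<^sub>1\<close> and
  \<open>1 - e\<close> pay for replacing \<open>j + 1\<close> by \<open>n\<close> and
  \<open>n\<close> by \<open>l\<close>.\<close>

lemma inverse_binomial_weight_ge:
  fixes e p :: real and j k n\<^sub>1 :: nat
  defines "n \<equiv> j + Suc k"
  defines "l \<equiv> real n / (1 - e)"
  assumes "0 < p" "p \<le> e" "e < 1" "k < n\<^sub>1" "n\<^sub>1 \<le> n"
  shows "(1 - real k / real n\<^sub>1) ^ k * (1 - e) ^ Suc k / real n * (l * erlang_density k 1 (l * p)) \<le>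
     1 / p * (real ((j + k) choose k) * p ^ Suc k * (1 - p) ^ j)"
proof -
  have l: "0 < l" using assms by (auto simp: l_def n_def)
  have n: "0 < real n" by (simp add: n_def)
  have "A ^ k * q ^ Suc k / real n * (l * erlang_density k 1 (l * p)) =
     (A * (q * l)) ^ k * p ^ k * (q * l / real n) * exp (- (l * p)) / fact k" for A q
  proof -
    have "\<not> l * p < 0" using l \<open>0 < p\<close> by (simp add: not_less)
    then show ?thesis by (simp add: erlang_density_def power_mult_distrib)
  qed
  then have "(1 - real k / real n\<^sub>1) ^ k * (1 - e) ^ Suc k / real n * (l * erlang_density k 1 (l * p)) =
     ((1 - real k / real n\<^sub>1) * ((1 - e) * l)) ^ k * p ^ k * ((1 - e) * l / real n) * exp (- (l * p)) / fact k" .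
  also have "(1 - e) * l = real n" using \<open>e < 1\<close> by (simp add: l_def)
  also have "((1 - real k / real n\<^sub>1) * real n) ^ k * p ^ k * (real n / real n) * exp (- (l * p)) / fact k =
     (((1 - real k / real n\<^sub>1) * real n) ^ k / fact k) * p ^ k * exp (- (l * p))"
    using n by simp
  also have "\<dots> \<le> ((real j + 1) ^ k / fact k) * p ^ k * exp (- (l * p))"
  proof (intro mult_right_mono divide_right_mono power_mono)
    have "real k / real n \<le> real k / real n\<^sub>1" using assms by (intro divide_left_mono) auto
    then have "(1 - real k / real n\<^sub>1) * real n \<le> (1 - real k / real n) * real n"
      by (intro mult_right_mono) auto
    also have "\<dots> = real j + 1" using n by (simp add: left_diff_distrib n_def)
    finally show "(1 - real k / real n\<^sub>1) * real n \<le> real j + 1" .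
    show "0 \<le> (1 - real k / real n\<^sub>1) * real n" using assms by (auto intro!: mult_nonneg_nonneg)
  qed (use \<open>0 < p\<close> in auto)
  also have "\<dots> \<le> real ((j + k) choose k) * p ^ k * (1 - p) ^ j"
    using binomial_ge_power_div_fact[of j k] one_minus_power_ge_exp[of p e j n] assms
    by (intro mult_mono) (auto simp: l_def n_def)
  also have "\<dots> = 1 / p * (real ((j + k) choose k) * p ^ Suc k * (1 - p) ^ j)"
    using \<open>0 < p\<close> by simp
  finally show ?thesis .
qed

text \<open>The substitution \<open>v = l * p\<close> turns \<open>L (x / p)\<close> into
  \<open>L (x * l / v)\<close>, so for fixed \<open>n\<close> an arbitrary estimate \<open>x\<close>
  acts as the constant \<open>W = x * l\<close>, to which the bound \<open>D\<close> applies. The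
  side conditions keep the image of the window \<open>{s..t}\<close> inside the support
  \<open>{del..e}\<close> of the prior.\<close>

lemma scaled_truncated_mean_le:
  fixes d e s t del x D :: real and j k n\<^sub>1 :: nat
  defines "n \<equiv> j + Suc k"
  assumes [measurable]: "L \<in> borel_measurable borel"
    and e: "0 < e" "e < 1" "k < n\<^sub>1" "n\<^sub>1 \<le> n" "t \<le> e * real n\<^sub>1" "0 < del" "real n / (1 - e) * del \<le> s"
    and D: "\<And>W. ennreal D \<le> erlang_mean k (\<lambda>v. indicator {s..t} v * L (W / v))"
  shows "ennreal ((1 - real k / real n\<^sub>1) ^ k * (1 - e) ^ Suc k / real n) * ennreal D \<le>
     (\<integral>\<^sup>+ p. indicator {del..e} p * (ennreal (1 / p * (real ((j + k) choose k) * p ^ Suc k * (1 - p) ^ j)) * L (x / p)) \<partial>lborel)"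
proof -
  define l where "l = real n / (1 - e)"
  define K where "K = (1 - real k / real n\<^sub>1) ^ k * (1 - e) ^ Suc k / real n"
  have l: "0 < l" using e by (auto simp: l_def n_def)
  have K: "0 \<le> K" using e by (auto simp: K_def)
  have nl: "real n \<le> l" using e by (auto simp: l_def n_def field_simps mult_le_cancel_left1)
  let ?f = "\<lambda>v. indicator {s..t} v * L (x * l / v)"
  have "ennreal K * ennreal D \<le> ennreal K * erlang_mean k ?f"
    by (intro mult_left_mono D) auto
  also have "erlang_mean k ?f = (\<integral>\<^sup>+ p. ennreal l * (ennreal (erlang_density k 1 (l * p)) * ?f (l * p)) \<partial>lborel)"
    unfolding erlang_mean_def using l
    by (subst nn_integral_real_affine[where c=l and t=0]) (auto simp: nn_integral_cmult)
  also have "ennreal K * \<dots> = (\<integral>\<^sup>+ p. indicator {s..t} (l * p) * (ennreal (K * (l * erlang_density k 1 (l * p))) * L (x * l / (l * p))) \<partial>lborel)"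
    using l K by (subst nn_integral_cmult[symmetric]) (auto simp: ennreal_mult ac_simps)
  also have "\<dots> \<le> (\<integral>\<^sup>+ p. indicator {del..e} p * (ennreal (1 / p * (real ((j + k) choose k) * p ^ Suc k * (1 - p) ^ j)) * L (x / p)) \<partial>lborel)"
  proof (intro nn_integral_mono)
    fix p :: real
    show "indicator {s..t} (l * p) * (ennreal (K * (l * erlang_density k 1 (l * p))) * L (x * l / (l * p))) \<le>
      indicator {del..e} p * (ennreal (1 / p * (real ((j + k) choose k) * p ^ Suc k * (1 - p) ^ j)) * L (x / p))"
    proof (cases "l * p \<in> {s..t}")
      case True
      have "l * del \<le> l * p" using True e by (simp add: l_def)
      then have p1: "del \<le> p" using l by simp
      have "l * p \<le> e * real n\<^sub>1" using True e by simp
      also have "\<dots> \<le> e * l" using e nl by (intro mult_left_mono) auto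
      finally have p2: "p \<le> e" using l by simp
      have x: "x * l / (l * p) = x / p" using l by simp
      have "K * (l * erlang_density k 1 (l * p)) \<le> 1 / p * (real ((j + k) choose k) * p ^ Suc k * (1 - p) ^ j)"
        using inverse_binomial_weight_ge[of p e k n\<^sub>1 j] p1 p2 e unfolding K_def l_def n_def by simp
      then have "ennreal (K * (l * erlang_density k 1 (l * p))) * L (x * l / (l * p)) \<le>
        ennreal (1 / p * (real ((j + k) choose k) * p ^ Suc k * (1 - p) ^ j)) * L (x / p)"
        unfolding x by (intro mult_right_mono ennreal_leI) auto
      moreover have "indicator {s..t} (l * p) = (1 :: ennreal)" "indicator {del..e} p = (1 :: ennreal)"
        using True p1 p2 by auto
      ultimately show ?thesis by (simp only: mult_1_left)
    qed simp
  qed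
  finally show ?thesis by (simp add: K_def)
qed

text \<open>The bound for a single \<open>n\<close> does not depend on the estimate
  \<open>x\<close>, so it survives averaging over \<open>K n\<close>, and randomization gives no
  advantage. Fubini's theorem exchanges this average with the prior, and only \<open>m\<close>
  values of \<open>n\<close>, from \<open>n\<^sub>1\<close> on, are kept.\<close>

lemma prior_risk_ge:
  fixes e s t del D :: real and k n\<^sub>1 m :: nat
  assumes [measurable]: "L \<in> borel_measurable borel" and K: "K \<in> estimators"
    and e: "0 < e" "e < 1" "k < n\<^sub>1" "t \<le> e * real n\<^sub>1" "0 < del" "real (n\<^sub>1 + m) / (1 - e) * del \<le> s" "0 \<le> D"
    and D: "\<And>W. ennreal D \<le> erlang_mean k (\<lambda>v. indicator {s..t} v * L (W / v))"
  shows "ennreal ((1 - real k / real n\<^sub>1) ^ k * (1 - e) ^ Suc k * D * (\<Sum>i<m. 1 / real (n\<^sub>1 + i))) \<le>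
     (\<integral>\<^sup>+ p. indicator {del..e} p * (ennreal (1 / p) * risk L (Suc k) K p) \<partial>lborel)"
proof -
  let ?w = "\<lambda>p j. real ((j + k) choose k) * p ^ Suc k * (1 - p) ^ j"
  \<comment> \<open>Number of failures when there are \<open>n\<^sub>1 + i\<close>
    observations.\<close>
  let ?j = "\<lambda>i. n\<^sub>1 - Suc k + i"
  define C where "C = (1 - real k / real n\<^sub>1) ^ k * (1 - e) ^ Suc k"
  have C: "0 \<le> C" using e by (auto simp: C_def)
  have jn: "?j i + Suc k = n\<^sub>1 + i" for i using e by simp
  have [measurable]: "K n \<in> space (prob_algebra borel)" for n
    using measurable_space[OF K[unfolded estimators_def]] by simp
  then have ps: "prob_space (K n)" and [simp, measurable_cong]: "sets (K n) = sets borel" for n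
    by (auto simp: space_prob_algebra)
  have "ennreal (C * D * (\<Sum>i<m. 1 / real (n\<^sub>1 + i))) = (\<Sum>i<m. ennreal (C / real (n\<^sub>1 + i)) * ennreal D)"
    using C e by (simp add: sum_distrib_left flip: ennreal_mult sum_ennreal)
  also have "\<dots> \<le> (\<Sum>i<m. \<integral>\<^sup>+ p. (\<integral>\<^sup>+ x. indicator {del..e} p * (ennreal (1 / p * ?w p (?j i)) * L (x / p)) \<partial>K (n\<^sub>1 + i)) \<partial>lborel)"
  proof (intro sum_mono)
    fix i assume i: "i \<in> {..<m}"
    interpret P: prob_space "K (n\<^sub>1 + i)" by (rule ps)
    interpret pair_sigma_finite "lborel :: real measure" "K (n\<^sub>1 + i)" ..
    have "real (n\<^sub>1 + i) / (1 - e) * del \<le> real (n\<^sub>1 + m) / (1 - e) * del"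
      using e i by (intro mult_right_mono divide_right_mono) auto
    then have "ennreal (C / real (n\<^sub>1 + i)) * ennreal D \<le>
      (\<integral>\<^sup>+ p. indicator {del..e} p * (ennreal (1 / p * ?w p (?j i)) * L (x / p)) \<partial>lborel)" for x
      using scaled_truncated_mean_le[OF assms(1), of e k n\<^sub>1 "?j i" t del s D x] e D jn[of i]
      unfolding C_def by (auto simp del: power_Suc)
    then have "(\<integral>\<^sup>+ x. ennreal (C / real (n\<^sub>1 + i)) * ennreal D \<partial>K (n\<^sub>1 + i)) \<le>
      (\<integral>\<^sup>+ x. (\<integral>\<^sup>+ p. indicator {del..e} p * (ennreal (1 / p * ?w p (?j i)) * L (x / p)) \<partial>lborel) \<partial>K (n\<^sub>1 + i))"
      by (intro nn_integral_mono)
    also have "\<dots> = (\<integral>\<^sup>+ p. (\<integral>\<^sup>+ x. indicator {del..e} p * (ennreal (1 / p * ?w p (?j i)) * L (x / p)) \<partial>K (n\<^sub>1 + i)) \<partial>lborel)"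
      by (intro Fubini') (measurable)
    finally show "ennreal (C / real (n\<^sub>1 + i)) * ennreal D \<le> \<dots>"
      by (simp add: P.emeasure_space_1)
  qed
  also have "\<dots> = (\<integral>\<^sup>+ p. (\<Sum>i<m. (\<integral>\<^sup>+ x. indicator {del..e} p * (ennreal (1 / p * ?w p (?j i)) * L (x / p)) \<partial>K (n\<^sub>1 + i))) \<partial>lborel)"
  proof (intro nn_integral_sum[symmetric])
    fix i
    interpret P: prob_space "K (n\<^sub>1 + i)" by (rule ps)
    show "(\<lambda>p. \<integral>\<^sup>+ x. indicator {del..e} p * (ennreal (1 / p * ?w p (?j i)) * L (x / p)) \<partial>K (n\<^sub>1 + i)) \<in> borel_measurable lborel"
      by measurable
  qed
  also have "\<dots> \<le> (\<integral>\<^sup>+ p. indicator {del..e} p * (ennreal (1 / p) * risk L (Suc k) K p) \<partial>lborel)"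
  proof (intro nn_integral_mono)
    fix p :: real
    show "(\<Sum>i<m. (\<integral>\<^sup>+ x. indicator {del..e} p * (ennreal (1 / p * ?w p (?j i)) * L (x / p)) \<partial>K (n\<^sub>1 + i)))
      \<le> indicator {del..e} p * (ennreal (1 / p) * risk L (Suc k) K p)"
    proof (cases "p \<in> {del..e}")
      case True
      then have p: "p \<in> {0<..1}" using e by auto
      let ?a = "\<lambda>j. ennreal (?w p j) * (\<integral>\<^sup>+ x. L (x / p) \<partial>K (j + Suc k))"
      have "(\<integral>\<^sup>+ x. indicator {del..e} p * (ennreal (1 / p * ?w p (?j i)) * L (x / p)) \<partial>K (n\<^sub>1 + i)) =
         ennreal (1 / p) * ?a (?j i)" for i
        using True p unfolding jn
        by (subst ennreal_mult) (auto simp: nn_integral_cmult mult.assoc simp del: power_Suc)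
      then have eq: "(\<Sum>i<m. (\<integral>\<^sup>+ x. indicator {del..e} p * (ennreal (1 / p * ?w p (?j i)) * L (x / p)) \<partial>K (n\<^sub>1 + i))) =
         ennreal (1 / p) * (\<Sum>i<m. ?a (?j i))"
        by (simp only: sum_distrib_left)
      have "(\<Sum>i<m. ?a (?j i)) = (\<Sum>j\<in>?j ` {..<m}. ?a j)"
        by (subst sum.reindex) (auto simp: inj_on_def)
      also have "\<dots> \<le> (\<Sum>j. ?a j)" by (intro sum_le_suminf) auto
      also have "\<dots> = risk L (Suc k) K p"
        by (simp only: nn_integral_risk[OF assms(1,2)] nn_integral_inverse_binomial[OF p])
      finally have "ennreal (1 / p) * (\<Sum>i<m. ?a (?j i)) \<le> ennreal (1 / p) * risk L (Suc k) K p"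
        by (rule mult_left_mono) simp
      moreover have "indicator {del..e} p = (1 :: ennreal)" using True by simp
      ultimately show ?thesis unfolding eq by (simp only: mult_1_left)
    qed simp
  qed
  finally show ?thesis by (simp add: C_def)
qed

text \<open>If the risk were at most \<open>c\<close> on \<open>(0, e]\<close>, its integral against
  the prior would be at most \<open>c * ln (e / del)\<close>. The lower bound grows like
  \<open>C * ln (N + m)\<close> with \<open>C > c\<close>, while \<open>del\<close> is of order
  \<open>1 / (N + m)\<close>; a large \<open>m\<close> gives a contradiction.\<close>

lemma no_asymptotic_risk_below_truncated_mean:
  fixes s t c D :: real
  assumes [measurable]: "L \<in> borel_measurable borel" and K: "K \<in> estimators"
    and st: "0 < s" "s < t" and cD: "0 \<le> c" "c < D"
    and D: "\<And>W. ennreal D \<le> erlang_mean k (\<lambda>v. indicator {s..t} v * L (W / v))"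
  shows "\<not> (\<forall>\<^sub>F p in at_right 0. risk L (Suc k) K p \<le> ennreal c)"
proof
  assume "\<forall>\<^sub>F p in at_right 0. risk L (Suc k) K p \<le> ennreal c"
  \<comment> \<open>First \<open>e\<close> and then \<open>N\<close> are chosen so that the
    correction factors leave the bound above \<open>c\<close>.\<close>
  moreover have "((\<lambda>e. (1 - e) ^ Suc k * D) \<longlongrightarrow> (1 - 0) ^ Suc k * D) (at_right 0)"
    by (intro tendsto_intros)
  then have "\<forall>\<^sub>F e in at_right 0. c < (1 - e) ^ Suc k * D"
    using cD by (intro order_tendstoD(1)) auto
  moreover have "\<forall>\<^sub>F e in at_right (0::real). e \<in> {0<..<1}" by (rule eventually_at_right_real) simp
  ultimately have "\<forall>\<^sub>F e in at_right 0. risk L (Suc k) K e \<le> ennreal c \<and> c < (1 - e) ^ Suc k * D \<and> e \<in> {0<..<1}"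
    by eventually_elim simp
  then obtain b where b: "0 < b" "\<And>e. 0 < e \<Longrightarrow> e < b \<Longrightarrow> risk L (Suc k) K e \<le> ennreal c \<and> c < (1 - e) ^ Suc k * D \<and> e \<in> {0<..<1}"
    unfolding eventually_at_right_field by auto
  define e where "e = b / 2"
  have e: "0 < e" "e < 1" "c < (1 - e) ^ Suc k * D" "\<And>p. 0 < p \<Longrightarrow> p \<le> e \<Longrightarrow> risk L (Suc k) K p \<le> ennreal c"
    using b(1) b(2)[of e] b(2) by (auto simp: e_def)
  have "((\<lambda>n. (1 - real k / real n) ^ k * (1 - e) ^ Suc k * D) \<longlongrightarrow> (1 - 0) ^ k * (1 - e) ^ Suc k * D) sequentially"
    by (intro tendsto_intros lim_const_over_n)
  then have "\<forall>\<^sub>F n in sequentially. c < (1 - real k / real n) ^ k * (1 - e) ^ Suc k * D"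
    using e by (intro order_tendstoD(1)) auto
  moreover have "\<forall>\<^sub>F n in sequentially. k < n" by (rule eventually_gt_at_top)
  moreover have "\<forall>\<^sub>F n in sequentially. t / e \<le> real n" 
    by (rule eventually_sequentiallyI[of "nat \<lceil>t / e\<rceil>"]) linarith
  ultimately have "\<forall>\<^sub>F n in sequentially. c < (1 - real k / real n) ^ k * (1 - e) ^ Suc k * D \<and> k < n \<and> t / e \<le> real n"
    by eventually_elim simp
  then obtain N where N: "c < (1 - real k / real N) ^ k * (1 - e) ^ Suc k * D" "k < N" "t / e \<le> real N"
    unfolding eventually_sequentially by blast
  define C where "C = (1 - real k / real N) ^ k * (1 - e) ^ Suc k * D"
  have bd: "(C - c) * ln (real N + real m) \<le> c * (ln e - ln (s * (1 - e))) + C * ln (real N)" for m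
  proof -
    \<comment> \<open>With this value \<open>(N + m) / (1 - e) * del = s\<close>, so the windows of
      all \<open>n\<close> up to \<open>N + m\<close> stay above \<open>del\<close>.\<close>
    define del where "del = s * (1 - e) / (real N + real m)"
    have del: "0 < del" using st e N by (simp add: del_def)
    have "del \<le> s / real N"
      unfolding del_def using st e N by (intro frac_le) (auto simp: mult_le_cancel_left1)
    also have "\<dots> \<le> e" using st e N by (simp add: field_simps)
    finally have dele: "del \<le> e" .
    have "ennreal (C * (\<Sum>i<m. 1 / real (N + i))) \<le> (\<integral>\<^sup>+ p. indicator {del..e} p * (ennreal (1 / p) * risk L (Suc k) K p) \<partial>lborel)"
      unfolding C_def
    proof (rule prior_risk_ge[OF assms(1) K e(1,2) N(2) _ del(1) _ _ D])
      show "t \<le> e * real N" using N(3) e by (simp add: field_simps)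
      show "real (N + m) / (1 - e) * del \<le> s" using e N by (simp add: del_def)
      show "0 \<le> D" using cD by simp
    qed
    also have "\<dots> \<le> (\<integral>\<^sup>+ p. ennreal c * (ennreal (1 / p) * indicator {del..e} p) \<partial>lborel)"
    proof (intro nn_integral_mono)
      fix p :: real
      show "indicator {del..e} p * (ennreal (1 / p) * risk L (Suc k) K p) \<le> ennreal c * (ennreal (1 / p) * indicator {del..e} p)"
      proof (cases "p \<in> {del..e}")
        case True
        then have "ennreal (1 / p) * risk L (Suc k) K p \<le> ennreal (1 / p) * ennreal c"
          using e(4)[of p] del by (intro mult_left_mono) auto
        then show ?thesis using True by (simp add: mult.commute)
      qed simp
    qed
    also have "\<dots> = ennreal c * ennreal (ln e - ln del)"
    proof -
      have "(\<integral>\<^sup>+ p. ennreal (1 / p) * indicator {del..e} p \<partial>lborel) = ennreal (ln e - ln del)"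
      proof (rule nn_integral_FTC_Icc[OF _ _ _ dele])
        fix p assume "p \<in> {del..e}"
        then have "0 < p" using del by simp
        then show "(ln has_real_derivative 1 / p) (at p)" by (auto intro!: derivative_eq_intros)
        show "0 \<le> 1 / p" using \<open>0 < p\<close> by simp
      qed simp
      then show ?thesis by (simp add: nn_integral_cmult)
    qed
    also have "\<dots> = ennreal (c * (ln e - ln del))" using cD del dele by (simp add: ennreal_mult)
    finally have "C * (\<Sum>i<m. 1 / real (N + i)) \<le> c * (ln e - ln del)"
      using cD del dele by (subst (asm) ennreal_le_iff) auto
    moreover have "C * (ln (real N + real m) - ln (real N)) \<le> C * (\<Sum>i<m. 1 / real (N + i))"
      using ln_le_sum_inverse[of "real N" m] N cD by (intro mult_left_mono) (auto simp: C_def)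
    moreover have "ln del = ln (s * (1 - e)) - ln (real N + real m)"
      unfolding del_def using st e N by (simp add: ln_div)
    ultimately show ?thesis by (simp add: algebra_simps)
  qed
  \<comment> \<open>\<open>B\<close> does not depend on \<open>m\<close>, yet it would bound every
    \<open>ln (N + m)\<close>.\<close>
  define B where "B = (c * (ln e - ln (s * (1 - e))) + C * ln (real N)) / (C - c)"
  have "0 < C - c" using N by (simp add: C_def)
  then have "ln (real N + real m) \<le> B" for m
    using bd[of m] by (simp add: B_def pos_le_divide_eq mult.commute)
  then have "real N + real m \<le> exp B" for m
    using N(2) by (subst ln_le_cancel_iff[symmetric]) auto
  moreover obtain m where "exp B < real m" using reals_Archimedean2 by blast
  ultimately show False by (smt (verit) of_nat_0_le_iff)
qed

section \<open>Attaining the lower bound\<close>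

text \<open>Every window contains \<open>[1, 2]\<close>, where the density is at least
  \<open>m\<close>. Coercivity makes the loss at least \<open>(\<bar>c\<bar> + 1) / m\<close> there
  once \<open>W j\<close> is large, which pushes the truncated mean above \<open>c\<close>.\<close>

lemma bounded_truncated_means:
  fixes L :: "real \<Rightarrow> ennreal" and W :: "nat \<Rightarrow> real" and c :: real
  assumes [measurable]: "L \<in> borel_measurable borel"
    and coercive: "\<And>M::real. \<exists>X. \<forall>x. X \<le> \<bar>x\<bar> \<longrightarrow> ennreal M \<le> L x"
    and W: "\<And>j. erlang_mean k (\<lambda>v. indicator {1 / (real j + 2)..real j + 2} v * L (W j / v)) \<le> ennreal c"
  shows "bounded (range W)"
proof -
  define m :: real where "m = (1 / 2) ^ k * exp (- 2) / fact k"
  have m: "0 < m" by (simp add: m_def)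
  obtain X where X: "\<And>x. X \<le> \<bar>x\<bar> \<Longrightarrow> ennreal ((\<bar>c\<bar> + 1) / m) \<le> L x" using coercive by blast
  \<comment> \<open>The factor 2 compensates for the division of \<open>W j\<close> by
    \<open>v\<close>, which is at most 2.\<close>
  have "\<bar>W j\<bar> \<le> 2 * \<bar>X\<bar>" for j
  proof (rule ccontr)
    assume "\<not> \<bar>W j\<bar> \<le> 2 * \<bar>X\<bar>"
    then have Wj: "2 * \<bar>X\<bar> < \<bar>W j\<bar>" by simp
    have "(\<integral>\<^sup>+ v. ennreal (\<bar>c\<bar> + 1) * indicator {1..2::real} v \<partial>lborel) \<le>
      erlang_mean k (\<lambda>v. indicator {1 / (real j + 2)..real j + 2} v * L (W j / v))"
      unfolding erlang_mean_def
    proof (intro nn_integral_mono)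
      fix v :: real
      show "ennreal (\<bar>c\<bar> + 1) * indicator {1..2} v \<le>
        ennreal (erlang_density k 1 v) * (indicator {1 / (real j + 2)..real j + 2} v * L (W j / v))"
      proof (cases "v \<in> {1..2}")
        case True
        have "X * v \<le> \<bar>X\<bar> * 2" using True by (intro mult_mono) auto
        then have "X \<le> \<bar>W j / v\<bar>" using Wj True by (simp add: field_simps)
        then have "ennreal ((\<bar>c\<bar> + 1) / m) \<le> L (W j / v)" by (rule X)
        moreover have "m \<le> erlang_density k 1 v"
          unfolding m_def erlang_density_def using True
          by (auto intro!: divide_right_mono mult_mono power_mono)
        ultimately have "ennreal m * ennreal ((\<bar>c\<bar> + 1) / m) \<le> ennreal (erlang_density k 1 v) * L (W j / v)"
          by (intro mult_mono ennreal_leI) auto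
        moreover have "ennreal m * ennreal ((\<bar>c\<bar> + 1) / m) = ennreal (\<bar>c\<bar> + 1)"
          using m by (simp flip: ennreal_mult)
        moreover have "1 / (real j + 2) \<le> v" using True by (simp add: field_simps) (smt (verit) mult_nonneg_nonneg of_nat_0_le_iff)
        ultimately show ?thesis using True by simp
      qed simp
    qed
    also have "\<dots> \<le> ennreal c" by (rule W)
    also have "\<dots> \<le> ennreal \<bar>c\<bar>" by (rule ennreal_leI) simp
    also have "(\<integral>\<^sup>+ v. ennreal (\<bar>c\<bar> + 1) * indicator {1..2::real} v \<partial>lborel) = ennreal (\<bar>c\<bar> + 1)"
      by (simp add: nn_integral_cmult)
    finally have "ennreal (\<bar>c\<bar> + 1) \<le> ennreal \<bar>c\<bar>" .
    then show False by (subst (asm) ennreal_le_iff) auto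
  qed
  then show ?thesis unfolding bounded_iff by auto
qed

text \<open>Compactness and Fatou's lemma: the constants chosen for the windows stay bounded, so a
  subsequence converges to some \<open>l\<close>. The windows exhaust the positive half-line and
  \<open>L\<close> is continuous, so \<open>l\<close> serves for the full mean.\<close>

lemma erlang_mean_le_of_truncated_means:
  fixes L :: "real \<Rightarrow> ennreal" and c :: real
  assumes L: "continuous_on UNIV L"
    and coercive: "\<And>M::real. \<exists>X. \<forall>x. X \<le> \<bar>x\<bar> \<longrightarrow> ennreal M \<le> L x"
    and c: "0 \<le> c"
    and W: "\<And>j. \<exists>W. erlang_mean k (\<lambda>v. indicator {1 / (real j + 2)..real j + 2} v * L (W / v)) \<le> ennreal (c + 1 / (real j + 1))"
  shows "\<exists>W. erlang_mean k (\<lambda>v. L (W / v)) \<le> ennreal c"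
proof -
  have [measurable]: "L \<in> borel_measurable borel" using L by (rule borel_measurable_continuous_onI)
  obtain W where W: "\<And>j. erlang_mean k (\<lambda>v. indicator {1 / (real j + 2)..real j + 2} v * L (W j / v)) \<le> ennreal (c + 1 / (real j + 1))"
    using W by metis
  have "ennreal (c + 1 / (real j + 1)) \<le> ennreal (c + 1)" for j by (intro ennreal_leI) simp
  then have "bounded (range W)"
    using W by (intro bounded_truncated_means[of L k W "c + 1"] coercive) (auto intro: order_trans)
  then obtain l \<sigma> where \<sigma>: "strict_mono \<sigma>" and l: "(W \<circ> \<sigma>) \<longlonglongrightarrow> l"
    using bounded_imp_convergent_subsequence by blast
  let ?u = "\<lambda>i v. ennreal (erlang_density k 1 v) * (indicator {1 / (real (\<sigma> i) + 2)..real (\<sigma> i) + 2} v * L (W (\<sigma> i) / v))"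
  have "erlang_mean k (\<lambda>v. L (l / v)) \<le> (\<integral>\<^sup>+ v. liminf (\<lambda>i. ?u i v) \<partial>lborel)"
    unfolding erlang_mean_def
  proof (intro nn_integral_mono_AE, use AE_lborel_singleton[of "0::real"] in eventually_elim)
    case (elim v)
    show ?case
    proof (cases "0 < v")
      case True
      obtain N where N: "1 / v \<le> real N" "v \<le> real N"
        by (metis linorder_linear order_trans real_arch_simple)
      have "\<forall>\<^sub>F i in sequentially. v \<in> {1 / (real (\<sigma> i) + 2)..real (\<sigma> i) + 2}"
      proof (rule eventually_sequentiallyI)
        fix i assume "N \<le> i"
        then have "real N \<le> real (\<sigma> i)" using seq_suble[OF \<sigma>, of i] by simp
        then have "1 / v \<le> real (\<sigma> i) + 2" "v \<le> real (\<sigma> i) + 2" using N by auto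
        then show "v \<in> {1 / (real (\<sigma> i) + 2)..real (\<sigma> i) + 2}" using True by (auto simp: field_simps)
      qed
      then have ev: "\<forall>\<^sub>F i in sequentially. ?u i v = ennreal (erlang_density k 1 v) * L (W (\<sigma> i) / v)"
        by eventually_elim simp
      have "(\<lambda>i. W (\<sigma> i) / v) \<longlonglongrightarrow> l / v"
        using l True by (intro tendsto_intros) (auto simp: o_def)
      then have "(\<lambda>i. L (W (\<sigma> i) / v)) \<longlonglongrightarrow> L (l / v)"
        by (intro continuous_on_tendsto_compose[OF L]) auto
      then have "(\<lambda>i. ennreal (erlang_density k 1 v) * L (W (\<sigma> i) / v)) \<longlonglongrightarrow> ennreal (erlang_density k 1 v) * L (l / v)"
        by (intro ennreal_tendsto_cmult) auto
      then have "(\<lambda>i. ?u i v) \<longlonglongrightarrow> ennreal (erlang_density k 1 v) * L (l / v)"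
        by (rule Lim_transform_eventually) (use ev in \<open>eventually_elim, simp\<close>)
      then show ?thesis by (simp add: lim_imp_Liminf)
    qed (use elim in \<open>simp add: erlang_density_def\<close>)
  qed
  also have "\<dots> \<le> liminf (\<lambda>i. \<integral>\<^sup>+ v. ?u i v \<partial>lborel)"
    by (intro nn_integral_liminf) measurable
  also have "\<dots> \<le> liminf (\<lambda>i. ennreal (c + 1 / (real (\<sigma> i) + 1)))"
    using W[unfolded erlang_mean_def] by (intro Liminf_mono always_eventually) auto
  also have "\<dots> = ennreal c"
  proof (rule lim_imp_Liminf)
    have "(\<lambda>n. c + 1 / (real n + 1)) \<longlonglongrightarrow> c + 0"
      using LIMSEQ_inverse_real_of_nat by (intro tendsto_intros) (simp add: inverse_eq_divide add.commute)
    then have "((\<lambda>n. c + 1 / (real n + 1)) \<circ> \<sigma>) \<longlonglongrightarrow> c"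
      using \<sigma> by (intro LIMSEQ_subseq_LIMSEQ) auto
    then show "(\<lambda>i. ennreal (c + 1 / (real (\<sigma> i) + 1))) \<longlonglongrightarrow> ennreal c"
      by (simp add: o_def)
  qed simp
  finally show ?thesis by blast
qed

text \<open>Averaging over the prior excludes risks below truncated means, with \<open>v\<close> in
  a window bounded away from 0 and infinity. Continuity and coercivity of the loss carry this over
  to the full mean.\<close>

lemma asymptotic_risk_ge_erlang_mean:
  fixes L :: "real \<Rightarrow> ennreal"
  assumes L: "continuous_on UNIV L"
    and coercive: "\<And>M::real. \<exists>X. \<forall>x. X \<le> \<bar>x\<bar> \<longrightarrow> ennreal M \<le> L x"
    and K: "K \<in> estimators"
  shows "\<exists>W. erlang_mean k (\<lambda>v. L (W / v)) \<le> asymptotic_risk L (Suc k) K"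
proof (cases "asymptotic_risk L (Suc k) K")
  case (real c)
  have "\<exists>W. erlang_mean k (\<lambda>v. indicator {1 / (real j + 2)..real j + 2} v * L (W / v)) \<le> ennreal (c + 1 / (real j + 1))" for j
  proof (rule ccontr)
    assume "\<not> ?thesis"
    then have D: "ennreal (c + 1 / (real j + 1)) \<le> erlang_mean k (\<lambda>v. indicator {1 / (real j + 2)..real j + 2} v * L (W / v))" for W
      by (meson linorder_linear)
    \<comment> \<open>Half of the excess \<open>1 / (real j + 1)\<close> leaves a value strictly
      above the asymptotic risk and strictly below all truncated means.\<close>
    have "\<not> (\<forall>\<^sub>F p in at_right 0. risk L (Suc k) K p \<le> ennreal (c + 1 / (real j + 1) / 2))"
    proof (rule no_asymptotic_risk_below_truncated_mean[OF borel_measurable_continuous_onI[OF L] K _ _ _ _ D])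
      show "1 / (real j + 2) < real j + 2" by (simp add: field_simps) (smt (verit) mult_nonneg_nonneg of_nat_0_le_iff)
    qed (use real in \<open>auto simp: field_simps\<close>)
    moreover have "asymptotic_risk L (Suc k) K < ennreal (c + 1 / (real j + 1) / 2)"
      using real by (auto intro!: ennreal_lessI)
    then have "\<forall>\<^sub>F p in at_right 0. risk L (Suc k) K p < ennreal (c + 1 / (real j + 1) / 2)"
      unfolding asymptotic_risk_def by (rule Limsup_lessD)
    then have "\<forall>\<^sub>F p in at_right 0. risk L (Suc k) K p \<le> ennreal (c + 1 / (real j + 1) / 2)"
      by eventually_elim simp
    ultimately show False by blast
  qed
  then show ?thesis unfolding real(2) using real(1) by (intro erlang_mean_le_of_truncated_means[OF L coercive]) auto
qed simp

text \<open>The same compactness argument, applied to near-minimisers. If the infimum is infinite,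
  every constant attains it.\<close>

lemma erlang_mean_attains_min:
  fixes L :: "real \<Rightarrow> ennreal"
  assumes L: "continuous_on UNIV L"
    and coercive: "\<And>M::real. \<exists>X. \<forall>x. X \<le> \<bar>x\<bar> \<longrightarrow> ennreal M \<le> L x"
  obtains W where "\<And>W'. erlang_mean k (\<lambda>v. L (W / v)) \<le> erlang_mean k (\<lambda>v. L (W' / v))"
proof (cases "INF W. erlang_mean k (\<lambda>v. L (W / v))")
  case (real c)
  have "\<exists>W. erlang_mean k (\<lambda>v. indicator {1 / (real j + 2)..real j + 2} v * L (W / v)) \<le> ennreal (c + 1 / (real j + 1))" for j
  proof -
    have "(INF W. erlang_mean k (\<lambda>v. L (W / v))) < ennreal (c + 1 / (real j + 1))"
      using real by (auto intro!: ennreal_lessI)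
    then obtain W where "erlang_mean k (\<lambda>v. L (W / v)) < ennreal (c + 1 / (real j + 1))"
      by (auto simp: INF_less_iff)
    moreover have "erlang_mean k (\<lambda>v. indicator {1 / (real j + 2)..real j + 2} v * L (W / v)) \<le> erlang_mean k (\<lambda>v. L (W / v))"
      unfolding erlang_mean_def by (intro nn_integral_mono mult_left_mono) (auto split: split_indicator)
    ultimately show ?thesis by (intro exI[of _ W]) simp
  qed
  then obtain W where "erlang_mean k (\<lambda>v. L (W / v)) \<le> ennreal c"
    using erlang_mean_le_of_truncated_means[OF L coercive real(1)] by blast
  then show ?thesis
    using real(2) by (intro that[of W]) (metis INF_lower UNIV_I order_trans)
next
  case top
  then show ?thesis
    by (intro that[of 0]) (metis INF_lower UNIV_I top_unique top_greatest)
qed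

section \<open>The two loss functions\<close>

lemma convex_on_max_real:
  fixes f g :: "real \<Rightarrow> real"
  assumes "convex_on A f" "convex_on A g"
  shows "convex_on A (\<lambda>x. max (f x) (g x))"
proof (rule convex_onI)
  fix t x y :: real assume *: "0 < t" "t < 1" "x \<in> A" "y \<in> A"
  let ?m = "\<lambda>x. max (f x) (g x)"
  have "(1 - t) * f x + t * f y \<le> (1 - t) * ?m x + t * ?m y"
    using * by (intro add_mono mult_left_mono) auto
  moreover have "(1 - t) * g x + t * g y \<le> (1 - t) * ?m x + t * ?m y"
    using * by (intro add_mono mult_left_mono) auto
  ultimately show "?m ((1 - t) *\<^sub>R x + t *\<^sub>R y) \<le> (1 - t) * ?m x + t * ?m y"
    using convex_onD[OF assms(1), of t x y] convex_onD[OF assms(2), of t x y] * by auto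
qed (use assms in \<open>auto intro: convex_on_imp_convex\<close>)

lemma loss_linear_eq: "loss_linear b b x = ennreal (b * \<bar>x - 1\<bar>)"
  by (simp add: loss_linear_def)

lemma loss_inverse_linear_eq:
  assumes "0 < x"
  shows "loss_inverse_linear b b x = ennreal (b * (max x (1 / x) - 1))"
proof (cases "x \<le> 1")
  case True
  then have "1 \<le> 1 / x" using assms by simp
  then have "max x (1 / x) = 1 / x" using True by simp
  then show ?thesis using True assms by (simp add: loss_inverse_linear_def)
next
  case False
  then have "1 / x \<le> 1" by simp
  then have "1 / x \<le> x" using False by linarith
  then have "max x (1 / x) = x" by (rule max_absorb1)
  then show ?thesis using False by (simp add: loss_inverse_linear_def)
qed

section \<open>Continuity and coercivity of the losses\<close>

lemma continuous_loss_linear: "continuous_on UNIV (loss_linear b b)"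
proof -
  have "continuous_on UNIV (\<lambda>x. ennreal (b * \<bar>x - 1\<bar>))"
    by (intro continuous_on_ennreal continuous_intros)
  then show ?thesis by (simp add: loss_linear_eq[symmetric])
qed

lemma coercive_loss_linear:
  fixes M :: real
  assumes "0 < b"
  shows "\<exists>X. \<forall>x. X \<le> \<bar>x\<bar> \<longrightarrow> ennreal M \<le> loss_linear b b x"
proof (intro exI allI impI)
  fix x :: real assume "1 + M / b \<le> \<bar>x\<bar>"
  then have "M / b \<le> \<bar>x - 1\<bar>" by simp
  then have "M \<le> b * \<bar>x - 1\<bar>" using assms by (simp add: field_simps)
  then show "ennreal M \<le> loss_linear b b x" unfolding loss_linear_eq by (rule ennreal_leI)
qed

text \<open>Continuity at 0 refers to the topology of \<open>ennreal\<close>: the infinite value on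
  the nonpositive reals matches the limit from the right.\<close>

lemma continuous_loss_inverse_linear:
  assumes b: "0 < b"
  shows "continuous_on UNIV (loss_inverse_linear b b)" (is "continuous_on _ ?L")
proof -
  have "isCont ?L x" for x
  proof (cases x "0::real" rule: linorder_cases)
    case less
    have "\<forall>\<^sub>F y in nhds x. y \<in> {..<0}" using less by (intro eventually_nhds_in_open) auto
    then have "\<forall>\<^sub>F y in nhds x. ?L y = top"
      by eventually_elim (simp add: loss_inverse_linear_def)
    then show ?thesis by (subst isCont_cong) auto
  next
    case greater
    have "\<forall>\<^sub>F y in nhds x. y \<in> {0<..}" using greater by (intro eventually_nhds_in_open) auto
    then have "\<forall>\<^sub>F y in nhds x. ?L y = ennreal (b * (max y (1 / y) - 1))"
      by eventually_elim (simp add: loss_inverse_linear_eq)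
    then have "isCont ?L x \<longleftrightarrow> isCont (\<lambda>y. ennreal (b * (max y (1 / y) - 1))) x" by (rule isCont_cong)
    moreover have "isCont (\<lambda>y. ennreal (b * (max y (1 / y) - 1))) x"
      using greater unfolding isCont_def by (intro tendsto_intros) auto
    ultimately show ?thesis by simp
  next
    case equal
    have "(?L \<longlongrightarrow> top) (at 0)"
    proof (rule order_tendstoI)
      fix a :: ennreal assume "a < top"
      then obtain m where m: "a = ennreal m" "0 \<le> m" by (cases a) auto
      \<comment> \<open>For \<open>0 < y < ?e\<close> the term \<open>b / y\<close> exceeds
        \<open>m + b + 1\<close>, so the loss still exceeds \<open>m\<close> after \<open>b\<close>
        is subtracted.\<close>
      let ?e = "b / (m + b + 1)"
      have "\<forall>\<^sub>F y in at 0. dist y 0 < ?e"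
        using b m unfolding eventually_at by (intro exI[of _ ?e]) auto
      then show "\<forall>\<^sub>F y in at 0. a < ?L y"
      proof eventually_elim
        case (elim y)
        show ?case
        proof (cases "y \<le> 0")
          case False
          then have "y * (m + b + 1) < b" using elim b m by (simp add: field_simps)
          then have "m + b + 1 < b / y" using False by (simp add: field_simps)
          also have "b / y \<le> b * max y (1 / y)"
            using b mult_left_mono[of "1 / y" "max y (1 / y)" b] by simp
          finally have "m < b * (max y (1 / y) - 1)" by (simp add: algebra_simps)
          then show ?thesis
            using False m by (simp add: loss_inverse_linear_eq ennreal_lessI)
        qed (simp add: loss_inverse_linear_def m)
      qed
    qed simp
    then show ?thesis using equal by (simp add: isCont_def loss_inverse_linear_def)
  qed
  then show ?thesis by (simp add: continuous_at_imp_continuous_on)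
qed

lemma coercive_loss_inverse_linear:
  fixes M :: real
  assumes "0 < b"
  shows "\<exists>X. \<forall>x. X \<le> \<bar>x\<bar> \<longrightarrow> ennreal M \<le> loss_inverse_linear b b x"
proof (intro exI allI impI)
  fix x :: real assume x: "1 + M / b \<le> \<bar>x\<bar>"
  show "ennreal M \<le> loss_inverse_linear b b x"
  proof (cases "x \<le> 0")
    case False
    then have "M / b \<le> max x (1 / x) - 1" using x by simp
    then have "M \<le> b * (max x (1 / x) - 1)" using assms by (simp add: field_simps)
    then show ?thesis using False by (simp add: loss_inverse_linear_eq ennreal_leI)
  qed (simp add: loss_inverse_linear_def)
qed

text \<open>The denominator \<open>n - 1\<close> is absorbed by the binomial coefficient, which turns the weights for
  \<open>k + 2\<close> successes into those for \<open>k + 1\<close> and leaves a Lipschitz function of \<open>p N\<close>.\<close>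

lemma risk_linear_eq:
  assumes p: "p \<in> {0<..<1}" and "0 \<le> b"
  shows "risk (loss_linear b b) (Suc (Suc k)) (nonrandomized (\<lambda>n. W / (real n - 1))) p =
    (\<integral>\<^sup>+ n. ennreal (b * \<bar>W - p * real n\<bar> / real (Suc k)) \<partial>measure_pmf (inverse_binomial_pmf (Suc k) p))"
proof -
  have p': "p \<in> {0<..1}" using p by simp
  show ?thesis
    unfolding risk_nonrandomized[OF borel_measurable_continuous_onI[OF continuous_loss_linear]]
      nn_integral_inverse_binomial[OF p'] loss_linear_eq
  proof (intro suminf_cong)
    fix j
    let ?n = "real (j + Suc k)"
    have n: "0 < ?n" by simp
    have "real (Suc k) * real ((j + Suc k) choose Suc k) = real (Suc (j + k)) * real ((j + k) choose k)"
      using Suc_times_binomial_eq[of "j + k" k] by (metis add_Suc_right mult.commute of_nat_mult)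
    then have C: "real ((j + Suc k) choose Suc k) = ?n * real ((j + k) choose k) / real (Suc k)"
      by (simp add: field_simps del: binomial_Suc_Suc of_nat_Suc)
    have "\<bar>W / (real (j + Suc (Suc k)) - 1) / p - 1\<bar> = \<bar>W - p * ?n\<bar> / (p * ?n)"
    proof -
      have "W / (real (j + Suc (Suc k)) - 1) / p - 1 = (W - p * ?n) / (p * ?n)"
        using p n by (simp add: field_simps del: of_nat_Suc) (simp add: algebra_simps)
      then show ?thesis using p n by (simp add: abs_divide abs_mult)
    qed
    then have "real ((j + Suc k) choose Suc k) * p ^ Suc (Suc k) * (1 - p) ^ j * (b * \<bar>W / (real (j + Suc (Suc k)) - 1) / p - 1\<bar>) =
      real ((j + k) choose k) * p ^ Suc k * (1 - p) ^ j * (b * \<bar>W - p * ?n\<bar> / real (Suc k))"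
      unfolding C using p n by (simp del: of_nat_Suc of_nat_add)
    moreover have "0 \<le> real ((j + Suc k) choose Suc k) * p ^ Suc (Suc k) * (1 - p) ^ j"
      "0 \<le> real ((j + k) choose k) * p ^ Suc k * (1 - p) ^ j"
      using p by (simp_all only: mult_nonneg_nonneg zero_le_power of_nat_0_le_iff greaterThanLessThan_iff
          less_imp_le diff_ge_0_iff_ge)
    ultimately show "ennreal (real ((j + Suc k) choose Suc k) * p ^ Suc (Suc k) * (1 - p) ^ j) * ennreal (b * \<bar>W / (real (j + Suc (Suc k)) - 1) / p - 1\<bar>) =
      ennreal (real ((j + k) choose k) * p ^ Suc k * (1 - p) ^ j) * ennreal (b * \<bar>W - p * ?n\<bar> / real (Suc k))"
      by (metis ennreal_mult')
  qed
qed

section \<open>Limits and suprema of the risks\<close>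

lemma erlang_density_Suc: "erlang_density (Suc k) 1 v = v / real (Suc k) * erlang_density k 1 v"
  by (simp add: erlang_density_def ac_simps)

text \<open>The counterpart, in the limit, of lowering the number of successes by one: the factor
  \<open>v\<close> split off from the density cancels the denominator in
  \<open>W / v - 1\<close>.\<close>

lemma erlang_mean_linear_eq:
  "erlang_mean (Suc k) (\<lambda>v. loss_linear b b (W / v)) = erlang_mean k (\<lambda>v. ennreal (b * \<bar>W - v\<bar> / real (Suc k)))"
  unfolding erlang_mean_def
proof (intro nn_integral_cong_AE, use AE_lborel_singleton[of "0::real"] in eventually_elim)
  case (elim v)
  show ?case
  proof (cases "0 < v")
    case True
    have "v * \<bar>W / v - 1\<bar> = \<bar>W - v\<bar>"
      using True by (simp add: abs_mult_pos' right_diff_distrib)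
    then have "erlang_density (Suc k) 1 v * (b * \<bar>W / v - 1\<bar>) = erlang_density k 1 v * (b * \<bar>W - v\<bar> / real (Suc k))"
      unfolding erlang_density_Suc by (metis (no_types, opaque_lifting) mult.assoc mult.commute times_divide_eq_right)
    then show ?thesis by (simp add: loss_linear_eq flip: ennreal_mult')
  qed (use elim in \<open>simp add: erlang_density_def\<close>)
qed

text \<open>The rewritten loss is a multiple of the distance from \<open>W\<close>, both convex and
  Lipschitz, so it serves as its own approximating sequence.\<close>

lemma linear_estimator_risk:
  assumes b: "0 < b"
  defines "L \<equiv> loss_linear b b"
  shows "(risk L (Suc (Suc k)) (nonrandomized (\<lambda>n. W / (real n - 1))) \<longlongrightarrow>
      erlang_mean (Suc k) (\<lambda>v. L (W / v))) (at_right 0)"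
    and "p \<in> {0<..<1} \<Longrightarrow> risk L (Suc (Suc k)) (nonrandomized (\<lambda>n. W / (real n - 1))) p \<le>
      erlang_mean (Suc k) (\<lambda>v. L (W / v))"
proof -
  define f where "f = (\<lambda>v. b * \<bar>W - v\<bar> / real (Suc k))"
  have m [measurable]: "f \<in> borel_measurable borel" unfolding f_def by measurable
  have "convex_on {0<..} (\<lambda>v. (b / real (Suc k)) * dist W v)"
    using b by (intro convex_on_cmul convex_on_dist) auto
  then have cvx: "convex_on {0<..} f" by (simp add: f_def dist_real_def)
  have nn: "0 \<le> f v" for v using b by (simp add: f_def)
  have lip: "\<exists>C. C-lipschitz_on {0<..} f"
  proof (intro exI lipschitz_onI)
    fix x y :: real
    have "dist (f x) (f y) = b / real (Suc k) * \<bar>\<bar>W - x\<bar> - \<bar>W - y\<bar>\<bar>"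
      using b by (simp add: f_def dist_real_def abs_mult abs_divide flip: right_diff_distrib diff_divide_distrib del: of_nat_Suc)
    also have "\<dots> \<le> b / real (Suc k) * dist x y"
      using b by (intro mult_left_mono) (auto simp: dist_real_def)
    finally show "dist (f x) (f y) \<le> b / real (Suc k) * dist x y" .
  qed (use b in simp)
  have R: "risk L (Suc (Suc k)) (nonrandomized (\<lambda>n. W / (real n - 1))) p =
      (\<integral>\<^sup>+ n. ennreal (f (p * real n)) \<partial>measure_pmf (inverse_binomial_pmf (Suc k) p))" if "p \<in> {0<..<1}" for p
    unfolding L_def f_def using b that by (intro risk_linear_eq) auto
  have H: "erlang_mean (Suc k) (\<lambda>v. L (W / v)) = erlang_mean k (\<lambda>v. ennreal (f v))"
    unfolding L_def f_def by (rule erlang_mean_linear_eq)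
  have "((\<lambda>p. \<integral>\<^sup>+ n. ennreal (f (p * real n)) \<partial>measure_pmf (inverse_binomial_pmf (Suc k) p))
    \<longlongrightarrow> erlang_mean k (\<lambda>v. ennreal (f v))) (at_right 0)"
    using lip nn by (intro inverse_binomial_tendsto_erlang_mean[where g="\<lambda>i. f"] cvx) (auto simp: incseq_def)
  then show "(risk L (Suc (Suc k)) (nonrandomized (\<lambda>n. W / (real n - 1))) \<longlongrightarrow>
      erlang_mean (Suc k) (\<lambda>v. L (W / v))) (at_right 0)"
    unfolding H
    by (rule Lim_transform_eventually)
      (use eventually_at_right_real[of 0 1] in \<open>auto elim!: eventually_mono simp: R\<close>)
  show "risk L (Suc (Suc k)) (nonrandomized (\<lambda>n. W / (real n - 1))) p \<le>
      erlang_mean (Suc k) (\<lambda>v. L (W / v))" if "p \<in> {0<..<1}"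
    unfolding R[OF that] H using that by (intro inverse_binomial_le_erlang_mean cvx nn) auto
qed

lemma inverse_linear_estimator_risk:
  assumes b: "0 < b" and W: "0 < W"
  defines "L \<equiv> loss_inverse_linear b b"
  shows "(risk L (Suc k) (nonrandomized (\<lambda>n. W / real n)) \<longlongrightarrow>
      erlang_mean k (\<lambda>v. L (W / v))) (at_right 0)"
    and "p \<in> {0<..<1} \<Longrightarrow> risk L (Suc k) (nonrandomized (\<lambda>n. W / real n)) p \<le>
      erlang_mean k (\<lambda>v. L (W / v))"
proof -
  \<comment> \<open>The two roles of \<open>v\<close> are separated: \<open>u\<close> enters the
    term that blows up at 0. Cutting \<open>u\<close> off at \<open>c i\<close> makes
    \<open>g i\<close> Lipschitz, and \<open>c i \<le> W\<close> keeps the maximum at least 1, hence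
    the loss nonnegative.\<close>
  define h where "h = (\<lambda>u v. b * (max (W / u) (v / W) - 1))"
  define f where "f = (\<lambda>v. h v v)"
  define c where "c = (\<lambda>i::nat. W / (real i + 1))"
  define g where "g = (\<lambda>i v. h (max v (c i)) v)"
  have c: "0 < c i" "c i \<le> W" for i using W by (auto simp: c_def field_simps)
  have m [measurable]: "f \<in> borel_measurable borel" "g i \<in> borel_measurable borel" for i
    unfolding f_def g_def h_def by measurable
  have const: "convex_on {0<..} (\<lambda>v::real. - 1 :: real)"
    by (rule convex_onI) (auto simp: algebra_simps)
  have lin: "convex_on {0<..} (\<lambda>v::real. v / W)"
    by (rule convex_onI) (auto simp: add_divide_distrib)
  have "convex_on {0<..} (\<lambda>v. b * (max (W * inverse v) (v / W) + (-1)))"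
    using b W by (intro convex_on_cmul convex_on_max_real lin convex_on_inverse convex_on_add const) auto
  then have cvx: "convex_on {0<..} f"
    by (simp add: f_def h_def divide_inverse)
  have nn: "0 \<le> h u v" if "0 < u" "u \<le> max v W" for u v
  proof -
    have "1 \<le> max (W / u) (v / W)" using that W by (auto simp: le_max_iff_disj)
    then show ?thesis using b by (simp add: h_def)
  qed
  have lip: "\<exists>C. C-lipschitz_on {0<..} (g i)" for i
  proof (intro exI lipschitz_onI)
    fix x y :: real
    let ?u = "\<lambda>x. max x (c i)"
    have u: "c i \<le> ?u x" "c i \<le> ?u y" "0 < ?u x" "0 < ?u y" using c(1)[of i] by auto
    have "W / ?u x - W / ?u y = W * (?u y - ?u x) / (?u x * ?u y)"
      using u by (simp add: field_simps)
    then have "\<bar>W / ?u x - W / ?u y\<bar> = W * \<bar>?u y - ?u x\<bar> / (?u x * ?u y)"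
      using u W by (simp add: abs_mult)
    also have "\<dots> \<le> W * \<bar>x - y\<bar> / (c i * c i)"
      using u W c(1)[of i] by (intro frac_le mult_left_mono mult_mono) auto
    finally have 1: "\<bar>W / ?u x - W / ?u y\<bar> \<le> W / (c i * c i) * \<bar>x - y\<bar>" by simp
    have 2: "\<bar>x / W - y / W\<bar> = 1 / W * \<bar>x - y\<bar>"
      using W by (simp add: abs_divide flip: diff_divide_distrib)
    have "\<bar>max (W / ?u x) (x / W) - max (W / ?u y) (y / W)\<bar> \<le> \<bar>W / ?u x - W / ?u y\<bar> + \<bar>x / W - y / W\<bar>"
      by (auto simp: max_def)
    also have "\<dots> \<le> (W / (c i * c i) + 1 / W) * \<bar>x - y\<bar>"
      using 1 2 by (simp add: distrib_right)
    finally have "b * \<bar>max (W / ?u x) (x / W) - max (W / ?u y) (y / W)\<bar> \<le> b * ((W / (c i * c i) + 1 / W) * \<bar>x - y\<bar>)"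
      using b by (intro mult_left_mono) auto
    moreover have "\<bar>g i x - g i y\<bar> = b * \<bar>max (W / ?u x) (x / W) - max (W / ?u y) (y / W)\<bar>"
      using b by (simp add: g_def h_def abs_mult flip: right_diff_distrib)
    ultimately show "dist (g i x) (g i y) \<le> (b * (W / (c i * c i) + 1 / W)) * dist x y"
      by (simp add: dist_real_def mult.assoc)
  qed (use b W c(1)[of i] in simp)
  have mono: "h u v \<le> h w v" if "0 < w" "w \<le> u" for u v w
  proof -
    have "W / u \<le> W / w" using that W by (intro divide_left_mono) auto
    then show ?thesis unfolding h_def using b by (intro mult_left_mono) auto
  qed
  have Lf: "L (W / v) = ennreal (f v)" if "0 < v" for v
    unfolding L_def f_def h_def using that W by (subst loss_inverse_linear_eq) auto
  have R: "risk L (Suc k) (nonrandomized (\<lambda>n. W / real n)) p =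
      (\<integral>\<^sup>+ n. ennreal (f (p * real n)) \<partial>measure_pmf (inverse_binomial_pmf (Suc k) p))" if p: "p \<in> {0<..<1}" for p
  proof -
    have "risk L (Suc k) (nonrandomized (\<lambda>n. W / real n)) p =
      (\<integral>\<^sup>+ n. L (W / real n / p) \<partial>measure_pmf (inverse_binomial_pmf (Suc k) p))"
      unfolding L_def by (rule risk_nonrandomized[OF borel_measurable_continuous_onI[OF continuous_loss_inverse_linear[OF b]]])
    also have "\<dots> = (\<integral>\<^sup>+ n. ennreal (f (p * real n)) \<partial>measure_pmf (inverse_binomial_pmf (Suc k) p))"
    proof (intro nn_integral_cong_AE, unfold AE_measure_pmf_iff, intro ballI)
      fix n assume "n \<in> set_pmf (inverse_binomial_pmf (Suc k) p)"
      then have "0 < n" by (auto simp: inverse_binomial_pmf_def)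
      then show "L (W / real n / p) = ennreal (f (p * real n))"
        using Lf[of "p * real n"] p by (simp add: mult.commute)
    qed
    finally show ?thesis .
  qed
  have H: "erlang_mean k (\<lambda>v. L (W / v)) = erlang_mean k (\<lambda>v. ennreal (f v))"
    unfolding erlang_mean_def
  proof (intro nn_integral_cong_AE, use AE_lborel_singleton[of "0::real"] in eventually_elim)
    case (elim v)
    then show ?case by (cases "0 < v") (auto simp: Lf erlang_density_def)
  qed
  have "((\<lambda>p. \<integral>\<^sup>+ n. ennreal (f (p * real n)) \<partial>measure_pmf (inverse_binomial_pmf (Suc k) p))
    \<longlongrightarrow> erlang_mean k (\<lambda>v. ennreal (f v))) (at_right 0)"
  proof (intro inverse_binomial_tendsto_erlang_mean[where g=g] cvx lip m)
    show "0 \<le> f v" if "0 < v" for v unfolding f_def using that by (intro nn) auto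
    show "0 \<le> g i v" if "0 < v" for i v unfolding g_def using that c[of i] by (intro nn) auto
    show "g i v \<le> f v" if "0 < v" for i v unfolding g_def f_def using that by (intro mono) auto
    show "incseq (\<lambda>i. g i v)" if "0 < v" for v
    proof (rule incseq_SucI)
      fix i
      have "c (Suc i) \<le> c i" using W by (auto simp: c_def intro!: divide_left_mono)
      then show "g i v \<le> g (Suc i) v" unfolding g_def using that by (intro mono) auto
    qed
    show "(\<lambda>i. g i v) \<longlonglongrightarrow> f v" if "0 < v" for v
    \<comment> \<open>For fixed \<open>v\<close> the cutoff is inactive from some \<open>i\<close>
      on.\<close>
    proof (rule tendsto_eventually, rule eventually_sequentiallyI)
      fix i assume "nat \<lceil>W / v\<rceil> \<le> i"
      then have "W / v \<le> real i + 1" by linarith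
      then have "c i \<le> v" using that by (simp add: c_def field_simps)
      then show "g i v = f v" by (simp add: g_def f_def max_absorb1)
    qed
  qed
  then show "(risk L (Suc k) (nonrandomized (\<lambda>n. W / real n)) \<longlongrightarrow>
      erlang_mean k (\<lambda>v. L (W / v))) (at_right 0)"
    unfolding H
    by (rule Lim_transform_eventually)
      (use eventually_at_right_real[of 0 1] in \<open>auto elim!: eventually_mono simp: R\<close>)
  show "risk L (Suc k) (nonrandomized (\<lambda>n. W / real n)) p \<le>
      erlang_mean k (\<lambda>v. L (W / v))" if "p \<in> {0<..<1}"
    unfolding R[OF that] H using that
    by (intro inverse_binomial_le_erlang_mean cvx m) (auto simp: f_def intro!: nn)
qed

section \<open>Moments and median of the gamma distribution\<close>

text \<open>The difference of the two sides vanishes at 0 and has the nonnegative derivative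
  \<open>2 / (1 - x\<^sup>2) - 2\<close>. Both the Stirling bound and the skewness of the gamma
  density rest on this.\<close>

lemma ln_ratio_ge:
  fixes u :: real
  assumes "0 \<le> u" "u < 1"
  shows "2 * u \<le> ln (1 + u) - ln (1 - u)"
proof -
  let ?f = "\<lambda>u::real. ln (1 + u) - ln (1 - u) - 2 * u"
  have "?f 0 \<le> ?f u"
  proof (rule DERIV_nonneg_imp_nondecreasing[OF assms(1)])
    fix x :: real assume x: "0 \<le> x" "x \<le> u"
    have "(?f has_real_derivative 1 / (1 + x) + 1 / (1 - x) - 2) (at x)"
      using x assms by (auto intro!: derivative_eq_intros simp: divide_simps)
    moreover have "0 \<le> 1 / (1 + x) + 1 / (1 - x) - 2"
    proof -
      have "1 / (1 + x) + 1 / (1 - x) = 2 / ((1 + x) * (1 - x))"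
        using x assms by (simp add: divide_simps)
      moreover have "0 < (1 + x) * (1 - x)" using x assms by (intro mult_pos_pos) auto
      moreover have "(1 + x) * (1 - x) \<le> 1" by (simp add: algebra_simps)
      ultimately have "2 \<le> 1 / (1 + x) + 1 / (1 - x)" 
        by (metis mult_2_right mult_left_mono mult.right_neutral pos_le_divide_eq zero_le_numeral)
      then show ?thesis by simp
    qed
    ultimately show "\<exists>y. (?f has_real_derivative y) (at x) \<and> 0 \<le> y" by metis
  qed
  then show ?thesis by simp
qed

text \<open>One half of Stirling's formula: \<open>(n + 1/2) * ln n - n - ln (fact n)\<close> equals
  \<open>-1\<close> at \<open>n = 1\<close> and does not decrease with \<open>n\<close>.\<close>

lemma power_exp_le_fact:
  "1 \<le> n \<Longrightarrow> exp (- 1) * sqrt (real n) \<le> real n * (real n ^ n * exp (- real n) / fact n)"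
proof -
  assume n: "1 \<le> n"
  then have "- 1 \<le> (real n + 1 / 2) * ln (real n) - real n - ln (fact n)"
  proof (induction n rule: dec_induct)
    case (step n)
    then have n: "0 < real n" by simp
    \<comment> \<open>With this value \<open>(1 + ?u) / (1 - ?u) = (n + 1) / n\<close>, and the
      logarithmic inequality becomes \<open>1 \<le> (n + 1/2) * ln ((n + 1) / n)\<close>, which says
      that the increment is nonnegative.\<close>
    let ?u = "1 / (2 * real n + 1)"
    have u: "0 < 1 - ?u" "0 < 1 + ?u" using n by (simp_all add: field_simps add_pos_pos)
    have "(1 + x) * y = (y + 1) * (1 - x)" if "x * (2 * y + 1) = 1" for x y :: real
      using that by (simp add: algebra_simps)
    then have "(1 + ?u) * real n = (real n + 1) * (1 - ?u)" using n by simp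
    then have "(1 + ?u) / (1 - ?u) = (real n + 1) / real n"
      using n u by (subst frac_eq_eq) auto
    then have "ln ((1 + ?u) / (1 - ?u)) = ln ((real n + 1) / real n)" by simp
    then have "ln (1 + ?u) - ln (1 - ?u) = ln (real n + 1) - ln (real n)"
      using n u by (simp only: ln_div) (auto split: if_splits)
    moreover have "2 * ?u \<le> ln (1 + ?u) - ln (1 - ?u)"
      using n by (intro ln_ratio_ge) (auto simp: field_simps)
    ultimately have "2 * ?u * (real n + 1 / 2) \<le> (ln (real n + 1) - ln (real n)) * (real n + 1 / 2)"
      using n by (intro mult_right_mono) auto
    moreover have "2 * ?u * (real n + 1 / 2) = 1" using n by (simp add: field_simps)
    moreover have "ln (fact (Suc n) :: real) = ln (real n + 1) + ln (fact n)"
      using n by (simp add: ln_mult add.commute)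
    ultimately show ?case using step.IH by (simp add: algebra_simps del: fact_Suc)
  qed simp
  then have "exp (- 1) \<le> exp ((real n + 1 / 2) * ln (real n) - real n - ln (fact n))" by simp
  also have "\<dots> = exp (real n * ln (real n)) * exp (ln (real n) / 2) * exp (- real n) / exp (ln (fact n))"
    by (simp only: distrib_right exp_add exp_diff diff_conv_add_uminus[of _ "real n"] mult_1_left times_divide_eq_left)
  also have "exp (real n * ln (real n)) = real n ^ n"
    using n by (simp add: exp_of_nat_mult)
  also have "exp (ln (real n) / 2) = sqrt (real n)"
    using n by (simp add: ln_sqrt[symmetric])
  finally have "exp (- 1) * sqrt (real n) \<le> real n ^ n * sqrt (real n) * exp (- real n) / fact n * sqrt (real n)"
    by (intro mult_right_mono) simp_all
  also have "\<dots> = (sqrt (real n) * sqrt (real n)) * (real n ^ n * exp (- real n) / fact n)" by simp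
  finally show ?thesis by simp
qed

section \<open>Calculus of gamma expectations\<close>

lemma erlang_mean_indicator_atMost:
  "erlang_mean k (indicator {..x}) = ennreal (erlang_CDF k 1 x)"
  unfolding erlang_mean_def by (rule nn_integral_erlang_density) simp

lemma erlang_mean_const: "erlang_mean k (\<lambda>v. c) = c"
  using nn_integral_erlang_ith_moment[of 1 k 0] unfolding erlang_mean_def
  by (simp add: nn_integral_multc)

lemma erlang_mean_add:
  assumes [measurable]: "f \<in> borel_measurable borel" "g \<in> borel_measurable borel"
  shows "erlang_mean k (\<lambda>v. f v + g v) = erlang_mean k f + erlang_mean k g"
  unfolding erlang_mean_def by (subst nn_integral_add[symmetric]) (auto simp: distrib_left)

lemma erlang_mean_cmult:
  assumes [measurable]: "f \<in> borel_measurable borel"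
  shows "erlang_mean k (\<lambda>v. c * f v) = c * erlang_mean k f"
  unfolding erlang_mean_def by (subst nn_integral_cmult[symmetric]) (auto simp: ac_simps)

lemma erlang_mean_mono:
  assumes "\<And>v. 0 < v \<Longrightarrow> f v \<le> g v"
  shows "erlang_mean k f \<le> erlang_mean k g"
  unfolding erlang_mean_def
proof (intro nn_integral_mono_AE, use AE_lborel_singleton[of "0::real"] in eventually_elim)
  case (elim v)
  then show ?case by (cases "0 < v") (auto simp: assms erlang_density_def intro!: mult_left_mono)
qed

lemma erlang_CDF_le_1: "erlang_CDF k 1 x \<le> 1"
proof -
  have "erlang_mean k (indicator {..x}) \<le> erlang_mean k (\<lambda>v. 1)"
    by (intro erlang_mean_mono) (auto split: split_indicator)
  then show ?thesis by (simp add: erlang_mean_indicator_atMost erlang_mean_const)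
qed

lemma erlang_CDF_mono: "x \<le> y \<Longrightarrow> erlang_CDF k 1 x \<le> erlang_CDF k 1 y"
proof -
  assume "x \<le> y"
  then have "erlang_mean k (indicator {..x}) \<le> erlang_mean k (indicator {..y})"
    by (intro erlang_mean_mono) (auto split: split_indicator)
  then show ?thesis by (simp add: erlang_mean_indicator_atMost)
qed

lemma erlang_mean_indicator_greaterThan:
  "erlang_mean k (indicator {x<..}) = ennreal (1 - erlang_CDF k 1 x)"
proof -
  have "ennreal (erlang_CDF k 1 x) + erlang_mean k (indicator {x<..}) =
     erlang_mean k (\<lambda>v. indicator {..x} v + indicator {x<..} v)"
    by (simp add: erlang_mean_add erlang_mean_indicator_atMost)
  also have "(\<lambda>v. indicator {..x} v + indicator {x<..} v) = (\<lambda>v::real. 1 :: ennreal)"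
    by (auto simp: fun_eq_iff split: split_indicator)
  finally have "ennreal (erlang_CDF k 1 x) + erlang_mean k (indicator {x<..}) = 1"
    by (simp add: erlang_mean_const)
  then have "erlang_mean k (indicator {x<..}) = 1 - ennreal (erlang_CDF k 1 x)"
    by (metis ennreal_add_diff_cancel_left ennreal_neq_top infinity_ennreal_def)
  then show ?thesis by (simp add: ennreal_minus flip: ennreal_1)
qed

text \<open>Size-biasing: a factor \<open>v\<close> raises the shape of the gamma law by one, at the
  cost of its mean \<open>Suc k\<close>.\<close>

lemma erlang_mean_times:
  assumes "0 \<le> c" and [measurable]: "g \<in> borel_measurable borel"
  shows "erlang_mean k (\<lambda>v. ennreal (c * v) * g v) = ennreal (c * real (Suc k)) * erlang_mean (Suc k) g"
proof -
  have "ennreal (erlang_density k 1 v) * (ennreal (c * v) * g v) =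
      ennreal (c * real (Suc k)) * (ennreal (erlang_density (Suc k) 1 v) * g v)" for v
  proof -
    have "erlang_density k 1 v * (c * v) = c * real (Suc k) * erlang_density (Suc k) 1 v"
      unfolding erlang_density_Suc by simp
    then have "ennreal (erlang_density k 1 v) * ennreal (c * v) = ennreal (c * real (Suc k)) * ennreal (erlang_density (Suc k) 1 v)"
      using assms(1) by (metis ennreal_mult' erlang_density_nonneg mult_nonneg_nonneg of_nat_0_le_iff zero_le_one)
    then show ?thesis by (metis mult.assoc)
  qed
  then show ?thesis
    unfolding erlang_mean_def by (simp add: nn_integral_cmult)
qed

lemma erlang_mean_divide:
  assumes "0 \<le> c" and [measurable]: "g \<in> borel_measurable borel"
  shows "erlang_mean (Suc k) (\<lambda>v. ennreal (c / v) * g v) = ennreal (c / real (Suc k)) * erlang_mean k g"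
proof -
  have "erlang_mean (Suc k) (\<lambda>v. ennreal (c / v) * g v) =
    (\<integral>\<^sup>+ v. ennreal (c / real (Suc k)) * (ennreal (erlang_density k 1 v) * g v) \<partial>lborel)"
    unfolding erlang_mean_def
  proof (intro nn_integral_cong_AE, use AE_lborel_singleton[of "0::real"] in eventually_elim)
    case (elim v)
    have "erlang_density (Suc k) 1 v * (c / v) = c / real (Suc k) * erlang_density k 1 v"
      unfolding erlang_density_Suc using elim by simp
    then have "ennreal (erlang_density (Suc k) 1 v) * ennreal (c / v) = ennreal (c / real (Suc k)) * ennreal (erlang_density k 1 v)"
      using assms(1) by (metis ennreal_mult' erlang_density_nonneg divide_nonneg_nonneg of_nat_0_le_iff zero_le_one)
    then show ?case by (metis mult.assoc)
  qed
  then show ?thesis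
    unfolding erlang_mean_def by (simp add: nn_integral_cmult)
qed

section \<open>The median between mode and mean\<close>

text \<open>With \<open>u = t / k\<close> the claim reduces to
  \<open>exp (2 * t) \<le> ((1 + u) / (1 - u)) ^ k\<close>, the \<open>k\<close>-th power of the
  exponentiated logarithmic inequality.\<close>

lemma erlang_density_reflect:
  assumes "0 \<le> t" "t \<le> real k"
  shows "erlang_density k 1 (real k - t) \<le> erlang_density k 1 (real k + t)"
proof (cases "t = real k")
  case True
  then show ?thesis by (cases k) (auto simp: erlang_density_def)
next
  case False
  then have k: "0 < real k" and t: "t < real k" using assms by auto
  let ?u = "t / real k"
  have u: "0 \<le> ?u" "?u < 1" using assms k t by auto
  have "exp (2 * ?u) \<le> exp (ln (1 + ?u) - ln (1 - ?u))" using ln_ratio_ge[OF u] by simp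
  also have "\<dots> = (1 + ?u) / (1 - ?u)" using u by (simp add: exp_diff)
  finally have "(1 - ?u) * exp (2 * ?u) \<le> 1 + ?u" using u by (simp add: field_simps)
  then have "real k * ((1 - ?u) * exp (2 * ?u)) \<le> real k * (1 + ?u)" using k by (intro mult_left_mono) auto
  moreover have "real k * (1 - ?u) = real k - t" "real k * (1 + ?u) = real k + t"
    using k by (simp_all add: right_diff_distrib distrib_left)
  ultimately have "(real k - t) * exp (2 * ?u) \<le> real k + t" by (simp only: flip: mult.assoc)
  then have "((real k - t) * exp (2 * ?u)) ^ k \<le> (real k + t) ^ k" using t by (intro power_mono) auto
  also have "((real k - t) * exp (2 * ?u)) ^ k = (real k - t) ^ k * exp (2 * t)"
    using k by (simp add: power_mult_distrib flip: exp_of_nat_mult)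
  finally have "(real k - t) ^ k * exp (2 * t) * exp (- (real k + t)) \<le> (real k + t) ^ k * exp (- (real k + t))"
    by (intro mult_right_mono) auto
  then have "(real k - t) ^ k * exp (- (real k - t)) \<le> (real k + t) ^ k * exp (- (real k + t))"
    by (simp add: mult.assoc flip: exp_add)
  then show ?thesis using t assms by (auto simp: erlang_density_def intro!: divide_right_mono)
qed

text \<open>The mass below the mode, reflected about it, is dominated pointwise by the density
  above, so it is at most the mass of the complement.\<close>

lemma erlang_CDF_mode: "erlang_CDF k 1 (real k) \<le> 1 / 2"
proof -
  have "erlang_mean k (indicator {..real k}) = (\<integral>\<^sup>+ v. ennreal (erlang_density k 1 (2 * real k - v)) * indicator {..real k} (2 * real k - v) \<partial>lborel)"
    unfolding erlang_mean_def
    by (subst nn_integral_real_affine[where c="-1" and t="2 * real k"]) auto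
  also have "\<dots> \<le> erlang_mean k (indicator {real k<..})"
    unfolding erlang_mean_def
  proof (intro nn_integral_mono_AE, use AE_lborel_singleton[of "real k"] in eventually_elim)
    case (elim v)
    show ?case
    \<comment> \<open>Beyond \<open>2 * k\<close> the reflected argument is negative, where the
      density vanishes; below \<open>k\<close> the reflected indicator vanishes.\<close>
    proof (cases "real k < v \<and> v \<le> 2 * real k")
      case True
      then show ?thesis using erlang_density_reflect[of "v - real k" k] by (auto intro!: ennreal_leI)
    qed (use elim in \<open>auto simp: erlang_density_def split: split_indicator\<close>)
  qed
  finally have "erlang_CDF k 1 (real k) \<le> 1 - erlang_CDF k 1 (real k)"
    using erlang_CDF_le_1[of k "real k"]
    by (simp add: erlang_mean_indicator_atMost erlang_mean_indicator_greaterThan)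
  then show ?thesis by simp
qed

text \<open>The distribution function of shape \<open>n\<close> at its mean \<open>n\<close> is a Poisson tail, so it suffices
  to compare the terms of the exponential series in pairs.\<close>

lemma poisson_terms_reflect:
  "i < n \<Longrightarrow> real n ^ (n - Suc i) / fact (n - Suc i) \<le> real n ^ (n + i) / fact (n + i)"
proof (induction i)
  case 0
  then obtain m where "n = Suc m" by (cases n) auto
  then show ?case by simp
next
  case (Suc i)
  define m where "m = n - Suc (Suc i)"
  have m: "n - Suc i = Suc m" using Suc.prems by (simp add: m_def)
  have nm: "real n = real m + real i + 2" using Suc.prems by (simp add: m_def of_nat_diff)
  have "real n ^ m / fact m = real n ^ Suc m / fact (Suc m) * (real (Suc m) / real n)"
    using Suc.prems by simp
  also have "\<dots> \<le> real n ^ (n + i) / fact (n + i) * (real n / real (Suc (n + i)))"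
  proof (intro mult_mono)
    show "real n ^ Suc m / fact (Suc m) \<le> real n ^ (n + i) / fact (n + i)"
      using Suc m by simp
    \<comment> \<open>The product is \<open>(n - (i + 1)) * (n + (i + 1))\<close>.\<close>
    have "real (Suc m) * real (Suc (n + i)) \<le> real n * real n"
      by (simp add: nm algebra_simps)
    then show "real (Suc m) / real n \<le> real n / real (Suc (n + i))"
      using Suc.prems by (subst frac_le_eq) (auto simp: divide_le_0_iff)
  qed auto
  also have "\<dots> = real n ^ (n + Suc i) / fact (n + Suc i)" by (simp add: ac_simps)
  finally show ?case by (simp add: m_def)
qed

lemma erlang_CDF_mean: "1 / 2 \<le> erlang_CDF k 1 (real (Suc k))"
proof -
  define n where "n = Suc k"
  let ?a = "\<lambda>i. real n ^ i / fact i"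
  have "(\<Sum>i<n. ?a i) = (\<Sum>i<n. ?a (n - Suc i))" by (rule sum.nat_diff_reindex[symmetric])
  also have "\<dots> \<le> (\<Sum>i<n. ?a (n + i))" by (intro sum_mono poisson_terms_reflect) auto
  \<comment> \<open>The dominating terms have the indices from \<open>n\<close> to
    \<open>2 * n - 1\<close>, so the first \<open>n\<close> terms make up at most half of the series
    for \<open>exp n\<close>.\<close>
  finally have "2 * (\<Sum>i<n. ?a i) \<le> (\<Sum>i<n. ?a i) + (\<Sum>i<n. ?a (n + i))" by simp
  also have "\<dots> = (\<Sum>i<n + n. ?a i)"
    by (simp add: lessThan_atLeast0 sum.atLeastLessThan_concat[of 0 n "n + n", symmetric]
        sum.shift_bounds_nat_ivl[of _ 0 n n, simplified] add.commute)
  also have "\<dots> \<le> (\<Sum>i. ?a i)"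
    using summable_exp[of "real n"] by (intro sum_le_suminf) (auto simp: field_simps)
  also have "\<dots> = exp (real n)" by (simp add: exp_def field_simps)
  finally have "2 * (\<Sum>i<n. ?a i) * exp (- real n) \<le> exp (real n) * exp (- real n)"
    by (intro mult_right_mono) auto
  then have "(\<Sum>i<n. ?a i) * exp (- real n) \<le> 1 / 2" by (simp flip: exp_add)
  moreover have "(\<Sum>i\<le>k. (1 * real n) ^ i * exp (- 1 * real n) / fact i) = (\<Sum>i<n. ?a i) * exp (- real n)"
    by (simp add: n_def sum_distrib_right lessThan_Suc_atMost)
  ultimately show ?thesis by (simp add: erlang_CDF_def n_def)
qed

section \<open>Location of the minimiser\<close>

text \<open>With \<open>n = Suc k\<close>, size-biasing bounds the mean deficit below by
  \<open>n\<close> times the difference of two consecutive distribution functions at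
  \<open>n\<close>. This difference is a single Poisson term, to which the Stirling bound applies.
  The result yields the order \<open>1 / sqrt r\<close> of the limiting risks.\<close>

lemma erlang_mean_deficit:
  "ennreal (exp (- 1) * sqrt (real (Suc k))) \<le>
    erlang_mean k (\<lambda>v. ennreal (real (Suc k) - v) * indicator {..real (Suc k)} v)" (is "_ \<le> ?X")
proof -
  let ?n = "real (Suc k)"
  have "ennreal ?n * erlang_mean k (indicator {..?n}) \<le>
    erlang_mean k (\<lambda>v. ennreal (?n - v) * indicator {..?n} v + ennreal (1 * v) * indicator {..?n} v)"
    unfolding erlang_mean_cmult[OF borel_measurable_indicator[OF borel_closed[OF closed_atMost]], symmetric]
    by (intro erlang_mean_mono) (auto split: split_indicator simp flip: ennreal_plus)
  also have "\<dots> = ?X + ennreal (1 * ?n) * erlang_mean (Suc k) (indicator {..?n})"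
    by (subst erlang_mean_add, simp, simp, subst erlang_mean_times) auto
  finally have "ennreal (?n * erlang_CDF k 1 ?n) \<le> ?X + ennreal (?n * erlang_CDF (Suc k) 1 ?n)"
    by (simp only: erlang_mean_indicator_atMost ennreal_mult' of_nat_0_le_iff mult_1_left)
  moreover have "exp (- 1) * sqrt ?n \<le> ?n * (erlang_CDF k 1 ?n - erlang_CDF (Suc k) 1 ?n)"
    using power_exp_le_fact[of "Suc k"] by (simp add: erlang_CDF_def del: fact_Suc power_Suc)
  ultimately show ?thesis
  proof (cases ?X)
    case (real x)
    then have "?n * erlang_CDF k 1 ?n \<le> x + ?n * erlang_CDF (Suc k) 1 ?n"
      using \<open>ennreal (?n * erlang_CDF k 1 ?n) \<le> ?X + ennreal (?n * erlang_CDF (Suc k) 1 ?n)\<close>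
      by (simp del: of_nat_Suc flip: ennreal_plus)
    then have "exp (- 1) * sqrt ?n \<le> x"
      using \<open>exp (- 1) * sqrt ?n \<le> _\<close> by (simp add: right_diff_distrib del: of_nat_Suc)
    then show ?thesis unfolding real(2) by (rule ennreal_leI)
  qed simp
qed

text \<open>A convexity bound at a kink: \<open>x\<close> and \<open>y\<close> are the integrands
  for a reference constant and for another one, \<open>d\<close> is the distance of the constants,
  and \<open>\<alpha>\<close>, \<open>\<beta>\<close> are slopes for \<open>v\<close> on either
  side. Negative terms are moved to the opposite side, so nothing is subtracted in
  \<open>ennreal\<close>.\<close>

lemma ennreal_indicator_tangent:
  fixes x y d \<alpha> \<beta> :: real
  assumes "v \<in> T \<longleftrightarrow> v \<notin> S" "0 \<le> x" "0 \<le> y" "0 \<le> d" "0 \<le> \<alpha>" "0 \<le> \<beta>"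
    and S: "v \<in> S \<Longrightarrow> x \<le> y + d * \<alpha>" and T: "v \<in> T \<Longrightarrow> x + d * \<beta> \<le> y"
  shows "ennreal x + ennreal d * (ennreal \<beta> * indicator T v) \<le> ennreal y + ennreal d * (ennreal \<alpha> * indicator S v)"
proof -
  have plus: "ennreal u + ennreal d * ennreal w = ennreal (u + d * w)" if "0 \<le> u" "0 \<le> w" for u w
    using that assms(4) by (simp add: ennreal_mult)
  show ?thesis
  proof (cases "v \<in> S")
    case True
    then show ?thesis using assms plus[of y \<alpha>] S by (auto simp del: ennreal_plus intro!: ennreal_leI)
  next
    case False
    then show ?thesis using assms plus[of x \<beta>] T by (auto simp del: ennreal_plus intro!: ennreal_leI)
  qed
qed

lemma erlang_mean_divide_atMost:
  "0 \<le> c \<Longrightarrow> erlang_mean (Suc k) (\<lambda>v. ennreal (c / v) * indicator {..x} v) = ennreal (c / real (Suc k) * erlang_CDF k 1 x)"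
  by (subst erlang_mean_divide)
    (auto simp: erlang_mean_indicator_atMost simp del: of_nat_Suc simp flip: ennreal_mult)

lemma erlang_mean_times_greaterThan:
  "0 \<le> c \<Longrightarrow> erlang_mean k (\<lambda>v. ennreal (c * v) * indicator {x<..} v) =
    ennreal (c * real (Suc k) * (1 - erlang_CDF (Suc k) 1 x))"
  by (subst erlang_mean_times)
    (auto simp: erlang_mean_indicator_greaterThan erlang_CDF_le_1 ennreal_mult simp del: of_nat_Suc)

text \<open>In effect \<open>f\<close> exceeds \<open>f\<^sub>1\<close> by at least
  \<open>d * (B - A)\<close>, which has nonnegative mean. Finiteness permits cancelling the mean of
  \<open>d * A\<close>.\<close>

lemma erlang_mean_le_by_tangent:
  assumes [measurable]: "f \<in> borel_measurable borel" "f\<^sub>1 \<in> borel_measurable borel"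
      "A \<in> borel_measurable borel" "B \<in> borel_measurable borel"
    and le: "\<And>v. 0 < v \<Longrightarrow> f\<^sub>1 v + d * B v \<le> f v + d * A v"
    and AB: "erlang_mean k A \<le> erlang_mean k B" and fin: "erlang_mean k A < top" "d < top"
  shows "erlang_mean k f\<^sub>1 \<le> erlang_mean k f"
proof -
  have "d * erlang_mean k A + erlang_mean k f\<^sub>1 \<le> d * erlang_mean k B + erlang_mean k f\<^sub>1"
    using AB by (intro add_right_mono mult_left_mono) auto
  also have "\<dots> = erlang_mean k (\<lambda>v. f\<^sub>1 v + d * B v)"
    by (simp add: erlang_mean_add erlang_mean_cmult add.commute)
  also have "\<dots> \<le> erlang_mean k (\<lambda>v. f v + d * A v)" by (intro erlang_mean_mono le)
  also have "\<dots> = d * erlang_mean k A + erlang_mean k f"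
    by (simp add: erlang_mean_add erlang_mean_cmult add.commute)
  finally show ?thesis
    using fin by (auto simp: ennreal_add_left_cancel_le ennreal_mult_eq_top_iff)
qed

text \<open>The mean absolute deviation is convex in \<open>W\<close> with its minimum at the
  median, which lies between \<open>k\<close> and \<open>k + 1\<close>. From outside this interval,
  moving to the nearer end point does not increase it; a move by at most one unit costs at most
  \<open>c\<close>.\<close>

lemma erlang_mean_abs_le:
  assumes c: "0 \<le> c"
  shows "erlang_mean k (\<lambda>v. ennreal (c * \<bar>real (Suc k) - v\<bar>)) \<le> erlang_mean k (\<lambda>v. ennreal (c * \<bar>W - v\<bar>)) + ennreal c"
proof -
  let ?h = "\<lambda>W. erlang_mean k (\<lambda>v. ennreal (c * \<bar>W - v\<bar>))"
  have near: "?h x \<le> ?h y + ennreal c" if "\<bar>x - y\<bar> \<le> 1" for x y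
  proof -
    have "?h x \<le> erlang_mean k (\<lambda>v. ennreal (c * \<bar>y - v\<bar>) + ennreal c)"
    proof (intro erlang_mean_mono)
      fix v :: real
      have "c * \<bar>x - v\<bar> \<le> c * (\<bar>y - v\<bar> + 1)" using that c by (intro mult_left_mono) auto
      then show "ennreal (c * \<bar>x - v\<bar>) \<le> ennreal (c * \<bar>y - v\<bar>) + ennreal c"
        using c by (simp add: distrib_left ennreal_leI flip: ennreal_plus)
    qed
    then show ?thesis by (simp add: erlang_mean_add erlang_mean_const)
  qed
  consider "W \<le> real k" | "real k < W" "W \<le> real (Suc k)" | "real (Suc k) < W" by linarith
  then show ?thesis
  proof cases
    case 1
    \<comment> \<open>The slope at \<open>k\<close> is \<open>c\<close> times the mass below
      \<open>k\<close> minus the mass above, nonpositive by the mode bound.\<close>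
    have "?h (real k) \<le> ?h W"
    proof (rule erlang_mean_le_by_tangent[where d="ennreal (real k - W)"
          and A="\<lambda>v. ennreal c * indicator {..real k} v" and B="\<lambda>v. ennreal c * indicator {real k<..} v"])
      fix v :: real
      show "ennreal (c * \<bar>real k - v\<bar>) + ennreal (real k - W) * (ennreal c * indicator {real k<..} v) \<le>
        ennreal (c * \<bar>W - v\<bar>) + ennreal (real k - W) * (ennreal c * indicator {..real k} v)"
      proof (rule ennreal_indicator_tangent)
        show "c * \<bar>real k - v\<bar> \<le> c * \<bar>W - v\<bar> + (real k - W) * c" if "v \<in> {..real k}"
        proof -
          have "c * (\<bar>real k - v\<bar>) \<le> c * (\<bar>W - v\<bar> + (real k - W))" using 1 that c by (intro mult_left_mono) auto
          then show ?thesis by (simp only: distrib_left mult.commute[of _ c])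
        qed
        show "c * \<bar>real k - v\<bar> + (real k - W) * c \<le> c * \<bar>W - v\<bar>" if "v \<in> {real k<..}"
        proof -
          have "c * (\<bar>real k - v\<bar> + (real k - W)) \<le> c * (\<bar>W - v\<bar>)" using 1 that c by (intro mult_left_mono) auto
          then show ?thesis by (simp only: distrib_left mult.commute[of _ c])
        qed
      qed (use 1 c in auto)
      have "ennreal (erlang_CDF k 1 (real k)) \<le> ennreal (1 - erlang_CDF k 1 (real k))"
        using erlang_CDF_mode[of k] by (intro ennreal_leI) simp
      then show "erlang_mean k (\<lambda>v. ennreal c * indicator {..real k} v) \<le> erlang_mean k (\<lambda>v. ennreal c * indicator {real k<..} v)"
        by (simp add: erlang_mean_cmult erlang_mean_indicator_atMost erlang_mean_indicator_greaterThan mult_left_mono)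
    qed (auto simp: erlang_mean_cmult erlang_mean_indicator_atMost ennreal_mult_less_top)
    moreover have "?h (real (Suc k)) \<le> ?h (real k) + ennreal c" by (rule near) simp
    ultimately show ?thesis by (meson add_right_mono order_trans)
  next
    case 2
    then show ?thesis by (intro near) auto
  next
    case 3
    \<comment> \<open>At the mean the two masses compare the other way round.\<close>
    have "?h (real (Suc k)) \<le> ?h W"
    proof (rule erlang_mean_le_by_tangent[where d="ennreal (W - real (Suc k))"
          and A="\<lambda>v. ennreal c * indicator {real (Suc k)<..} v" and B="\<lambda>v. ennreal c * indicator {..real (Suc k)} v"])
      fix v :: real
      show "ennreal (c * \<bar>real (Suc k) - v\<bar>) + ennreal (W - real (Suc k)) * (ennreal c * indicator {..real (Suc k)} v) \<le>
        ennreal (c * \<bar>W - v\<bar>) + ennreal (W - real (Suc k)) * (ennreal c * indicator {real (Suc k)<..} v)"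
      proof (rule ennreal_indicator_tangent)
        show "c * \<bar>real (Suc k) - v\<bar> \<le> c * \<bar>W - v\<bar> + (W - real (Suc k)) * c" if "v \<in> {real (Suc k)<..}"
        proof -
          have "c * (\<bar>real (Suc k) - v\<bar>) \<le> c * (\<bar>W - v\<bar> + (W - real (Suc k)))" using 3 that c by (intro mult_left_mono) auto
          then show ?thesis by (simp only: distrib_left mult.commute[of _ c])
        qed
        show "c * \<bar>real (Suc k) - v\<bar> + (W - real (Suc k)) * c \<le> c * \<bar>W - v\<bar>" if "v \<in> {..real (Suc k)}"
        proof -
          have "c * (\<bar>real (Suc k) - v\<bar> + (W - real (Suc k))) \<le> c * (\<bar>W - v\<bar>)" using 3 that c by (intro mult_left_mono) auto
          then show ?thesis by (simp only: distrib_left mult.commute[of _ c])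
        qed
      qed (use 3 c in auto)
      have "ennreal (1 - erlang_CDF k 1 (real (Suc k))) \<le> ennreal (erlang_CDF k 1 (real (Suc k)))"
        using erlang_CDF_mean[of k] by (intro ennreal_leI) simp
      then show "erlang_mean k (\<lambda>v. ennreal c * indicator {real (Suc k)<..} v) \<le> erlang_mean k (\<lambda>v. ennreal c * indicator {..real (Suc k)} v)"
        by (simp add: erlang_mean_cmult erlang_mean_indicator_atMost erlang_mean_indicator_greaterThan mult_left_mono del: of_nat_Suc)
    qed (auto simp: erlang_mean_cmult erlang_mean_indicator_greaterThan ennreal_mult_less_top simp del: of_nat_Suc)
    then show ?thesis by (rule order_trans) simp
  qed
qed

text \<open>By convexity \<open>v / W\<close> lies above its tangent at \<open>W\<^sub>1\<close>;
  the gap is a multiple of \<open>(W - W\<^sub>1)\<^sup>2\<close>.\<close>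

lemma inverse_ge_tangent:
  fixes v W W\<^sub>1 :: real
  assumes "0 \<le> v" "0 < W" "0 < W\<^sub>1"
  shows "v / W\<^sub>1 + (W\<^sub>1 - W) * (v / W\<^sub>1\<^sup>2) \<le> v / W"
proof -
  have "v / W - (v / W\<^sub>1 + (W\<^sub>1 - W) * (v / W\<^sub>1\<^sup>2)) = v * (W - W\<^sub>1)\<^sup>2 / (W * W\<^sub>1\<^sup>2)"
    using assms by (simp add: field_simps power2_eq_square)
  moreover have "0 \<le> v * (W - W\<^sub>1)\<^sup>2 / (W * W\<^sub>1\<^sup>2)" using assms by simp
  ultimately show ?thesis by simp
qed

text \<open>The slope of \<open>h\<close> at \<open>x\<close> compares the mean of
  \<open>b / v\<close> below \<open>x\<close> with that of \<open>b * v / x\<^sup>2\<close> above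
  \<open>x\<close>. Shifting the shape by one turns these into distribution functions of index
  \<open>j\<close> and \<open>j + 2\<close>, whose mode and mean bounds show that moving
  \<open>W\<close> to the nearer end of \<open>[j, j + 3]\<close> does not increase
  \<open>h\<close>. Within this interval ratios are at most \<open>1 + 3 / j\<close>.\<close>

lemma erlang_mean_max_le:
  assumes b: "0 < b" and j: "1 \<le> j" and W: "0 < W" and W': "real (j + 1) \<le> W'" "W' \<le> real (j + 2)"
  defines "h \<equiv> \<lambda>W. erlang_mean (Suc j) (\<lambda>v. ennreal (b * (max (W / v) (v / W) - 1)))"
  shows "h W' \<le> ennreal (1 + 3 / real j) * h W + ennreal (b * (3 / real j))"
proof -
  let ?m = "\<lambda>W v. max (W / v) (v / W)"
  have m_below: "?m x v = x / v" if "0 < v" "v \<le> x" for x v :: real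
  proof (rule max_absorb1)
    have "v / x \<le> 1" "1 \<le> x / v" using that by simp_all
    then show "v / x \<le> x / v" by simp
  qed
  have m_above: "?m x v = v / x" if "0 < x" "x < v" for x v :: real
  proof (rule max_absorb2)
    have "x / v \<le> 1" "1 \<le> v / x" using that by simp_all
    then show "x / v \<le> v / x" by simp
  qed
  have m_nonneg: "0 \<le> b * (?m x v - 1)" if "0 < x" "0 < v" for x v :: real
  proof -
    have "1 \<le> ?m x v" using that by (auto simp: le_max_iff_disj)
    then show ?thesis using b by simp
  qed
  have near: "h W' \<le> ennreal (1 + 3 / real j) * h x + ennreal (b * (3 / real j))" if x: "real j \<le> x" "x \<le> real (j + 3)" for x
  proof -
    have "h W' \<le> erlang_mean (Suc j) (\<lambda>v. ennreal (1 + 3 / real j) * ennreal (b * (?m x v - 1)) + ennreal (b * (3 / real j)))"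
      unfolding h_def
    proof (intro erlang_mean_mono)
      fix v :: real assume v: "0 < v"
      have pos: "0 < x" "0 < W'" "0 < real j" using x j W' by auto
      have m1: "1 \<le> ?m x v" using v pos by (auto simp: le_max_iff_disj)
      have j3: "(1 + 3 / real j) * real j = real j + 3" using pos by (simp add: distrib_right)
      have "W' \<le> (1 + 3 / real j) * x"
      proof -
        have "W' \<le> (1 + 3 / real j) * real j" using W' unfolding j3 by simp
        also have "\<dots> \<le> (1 + 3 / real j) * x" using x by (intro mult_left_mono) auto
        finally show ?thesis .
      qed
      then have "W' / v \<le> (1 + 3 / real j) * x / v" using v by (intro divide_right_mono) auto
      also have "\<dots> \<le> (1 + 3 / real j) * ?m x v"
        unfolding times_divide_eq_right[symmetric] by (intro mult_left_mono) auto
      finally have 1: "W' / v \<le> (1 + 3 / real j) * ?m x v" .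
      have "x \<le> (1 + 3 / real j) * W'"
      proof -
        have "x \<le> (1 + 3 / real j) * real j" using x unfolding j3 by simp
        also have "\<dots> \<le> (1 + 3 / real j) * W'" using W' by (intro mult_left_mono) auto
        finally show ?thesis .
      qed
      then have "1 / W' \<le> (1 + 3 / real j) / x" using pos by (simp add: field_simps)
      then have "v * (1 / W') \<le> v * ((1 + 3 / real j) / x)" using v by (intro mult_left_mono) auto
      also have "\<dots> = (1 + 3 / real j) * (v / x)" by simp
      also have "\<dots> \<le> (1 + 3 / real j) * ?m x v" by (intro mult_left_mono) auto
      finally have "v / W' \<le> (1 + 3 / real j) * ?m x v" by simp
      with 1 have "?m W' v - 1 \<le> (1 + 3 / real j) * ?m x v - 1" by simp
      then have "b * (?m W' v - 1) \<le> b * ((1 + 3 / real j) * ?m x v - 1)" using b by (intro mult_left_mono) auto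
      also have "\<dots> = (1 + 3 / real j) * (b * (?m x v - 1)) + b * (3 / real j)" by (simp add: algebra_simps)
      finally have "ennreal (b * (?m W' v - 1)) \<le> ennreal \<dots>" by (rule ennreal_leI)
      also have "\<dots> = ennreal (1 + 3 / real j) * ennreal (b * (?m x v - 1)) + ennreal (b * (3 / real j))"
        using b m1 by (subst ennreal_plus) (auto simp: ennreal_mult')
      finally show "ennreal (b * (?m W' v - 1)) \<le> \<dots>" .
    qed
    also have "\<dots> = ennreal (1 + 3 / real j) * h x + ennreal (b * (3 / real j))"
      unfolding h_def by (simp add: erlang_mean_add erlang_mean_cmult erlang_mean_const)
    finally show ?thesis .
  qed
  have up: "h W' \<le> ennreal (1 + 3 / real j) * h W + ennreal (b * (3 / real j))"
    if "h x \<le> h W" "real j \<le> x" "x \<le> real (j + 3)" for x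
    using near[OF that(2,3)] that(1) by (meson add_right_mono mult_left_mono order_trans zero_le)
  consider "W \<le> real j" | "real j < W" "W \<le> real (j + 3)" | "real (j + 3) < W" by linarith
  then show ?thesis
  proof cases
    case 1
    let ?A = "\<lambda>v. ennreal (b / v) * indicator {..real j} v"
    let ?B = "\<lambda>v. ennreal (b / (real j)\<^sup>2 * v) * indicator {real j<..} v"
    have "h (real j) \<le> h W"
      unfolding h_def
    proof (rule erlang_mean_le_by_tangent[where d="ennreal (real j - W)" and A="?A" and B="?B"])
      fix v :: real assume v: "0 < v"
      show "ennreal (b * (?m (real j) v - 1)) + ennreal (real j - W) * ?B v \<le>
        ennreal (b * (?m W v - 1)) + ennreal (real j - W) * ?A v"
      proof (rule ennreal_indicator_tangent)
        assume "v \<in> {..real j}"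
        then have "?m (real j) v = real j / v" using v m_below by simp
        moreover have "W / v + (real j - W) / v = real j / v" by (simp flip: add_divide_distrib)
        ultimately have "?m (real j) v \<le> ?m W v + (real j - W) / v" by linarith
        then have "b * (?m (real j) v - 1) \<le> b * (?m W v - 1 + (real j - W) / v)"
          using b by (intro mult_left_mono) auto
        then show "b * (?m (real j) v - 1) \<le> b * (?m W v - 1) + (real j - W) * (b / v)" by (simp add: distrib_left mult.commute)
      next
        assume "v \<in> {real j<..}"
        then have "?m (real j) v = v / real j" using j m_above by simp
        then have "?m (real j) v + (real j - W) * (v / (real j)\<^sup>2) \<le> ?m W v"
          using inverse_ge_tangent[of v W "real j"] v W j by simp
        then have "b * (?m (real j) v + (real j - W) * (v / (real j)\<^sup>2) - 1) \<le> b * (?m W v - 1)"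
          using b by (intro mult_left_mono) auto
        also have "b * (?m (real j) v + (real j - W) * (v / (real j)\<^sup>2) - 1) =
          b * (?m (real j) v - 1) + (real j - W) * (b / (real j)\<^sup>2 * v)" by (simp add: algebra_simps)
        finally show "b * (?m (real j) v - 1) + (real j - W) * (b / (real j)\<^sup>2 * v) \<le> b * (?m W v - 1)" .
      qed (use 1 v W j b m_nonneg in auto)
    next
      \<comment> \<open>Both sides are compared with \<open>b / (2 * j)\<close>: the laws of index
        \<open>j\<close> and \<open>j + 2\<close> have modes \<open>j\<close> and
        \<open>j + 2\<close>, so at most half of either mass lies below \<open>j\<close>.\<close>
      have "b / real (Suc j) * erlang_CDF j 1 (real j) \<le> b / real j * (1 / 2)"
        using erlang_CDF_mode[of j] b j by (intro mult_mono divide_left_mono) auto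
      also have "\<dots> = b / (real j)\<^sup>2 * real j * (1 / 2)" using j by (simp add: power2_eq_square)
      also have "\<dots> \<le> b / (real j)\<^sup>2 * real (Suc (Suc j)) * (1 - erlang_CDF (Suc (Suc j)) 1 (real j))"
        using b erlang_CDF_mode[of "Suc (Suc j)"] erlang_CDF_mono[of "real j" "real (Suc (Suc j))" "Suc (Suc j)"]
        by (intro mult_mono) auto
      finally show "erlang_mean (Suc j) ?A \<le> erlang_mean (Suc j) ?B"
        using b by (subst erlang_mean_divide_atMost, simp, subst erlang_mean_times_greaterThan, simp) (rule ennreal_leI)
      show "erlang_mean (Suc j) ?A < top"
        using b by (subst erlang_mean_divide_atMost) auto
    qed auto
    then show ?thesis by (rule up) auto
  next
    case 2
    then show ?thesis by (intro near) auto
  next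
    case 3
    define x where "x = real (j + 3)"
    have x: "0 < x" "x < W" using 3 by (simp_all add: x_def)
    let ?A = "\<lambda>v. ennreal (b / x\<^sup>2 * v) * indicator {x<..} v"
    let ?B = "\<lambda>v. ennreal (b / v) * indicator {..x} v"
    have "h x \<le> h W"
      unfolding h_def
    proof (rule erlang_mean_le_by_tangent[where d="ennreal (W - x)" and A="?A" and B="?B"])
      fix v :: real assume v: "0 < v"
      show "ennreal (b * (?m x v - 1)) + ennreal (W - x) * ?B v \<le>
        ennreal (b * (?m W v - 1)) + ennreal (W - x) * ?A v"
      proof (rule ennreal_indicator_tangent)
        assume "v \<in> {..x}"
        then have "?m x v = x / v" using v m_below by simp
        moreover have "x / v + (W - x) / v = W / v" by (simp flip: add_divide_distrib)
        ultimately have "?m x v + (W - x) / v \<le> ?m W v" by linarith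
        then have "b * (?m x v + (W - x) / v - 1) \<le> b * (?m W v - 1)"
          using b by (intro mult_left_mono) auto
        also have "b * (?m x v + (W - x) / v - 1) = b * (?m x v - 1) + (W - x) * (b / v)"
          by (simp add: algebra_simps)
        finally show "b * (?m x v - 1) + (W - x) * (b / v) \<le> b * (?m W v - 1)" .
      next
        assume "v \<in> {x<..}"
        then have "?m x v = v / x" using x m_above by simp
        also have "v / x \<le> v / W + (W - x) * (v / x\<^sup>2)"
          using inverse_ge_tangent[OF less_imp_le[OF v] W x(1)] by (simp add: left_diff_distrib diff_divide_distrib)
        also have "\<dots> \<le> ?m W v + (W - x) * (v / x\<^sup>2)" by simp
        finally have "?m x v \<le> ?m W v + (W - x) * (v / x\<^sup>2)" .
        then have "b * (?m x v - 1) \<le> b * (?m W v + (W - x) * (v / x\<^sup>2) - 1)"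
          using b by (intro mult_left_mono) auto
        also have "\<dots> = b * (?m W v - 1) + (W - x) * (b / x\<^sup>2 * v)" by (simp add: algebra_simps)
        finally show "b * (?m x v - 1) \<le> b * (?m W v - 1) + (W - x) * (b / x\<^sup>2 * v)" .
      qed (use x v W b m_nonneg in auto)
    next
      \<comment> \<open>Both sides are compared with \<open>b / (2 * x)\<close>: the point
        \<open>x = j + 3\<close> is the mean of the law of index \<open>j + 2\<close> and lies above
        the mean \<open>j + 1\<close> of that of index \<open>j\<close>.\<close>
      have "b / x\<^sup>2 * real (Suc (Suc j)) * (1 - erlang_CDF (Suc (Suc j)) 1 x) \<le> b / x\<^sup>2 * x * (1 / 2)"
        using b erlang_CDF_mean[of "Suc (Suc j)"] erlang_CDF_le_1[of "Suc (Suc j)" x]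
        by (intro mult_mono) (auto simp: add.commute x_def)
      also have "\<dots> = b / x * (1 / 2)" by (simp add: power2_eq_square)
      also have "\<dots> \<le> b / real (Suc j) * erlang_CDF j 1 x"
        using b erlang_CDF_mean[of j] erlang_CDF_mono[of "real (Suc j)" x j]
        by (intro mult_mono divide_left_mono) (auto simp: x_def)
      finally show "erlang_mean (Suc j) ?A \<le> erlang_mean (Suc j) ?B"
        using b by (subst erlang_mean_divide_atMost, simp, subst erlang_mean_times_greaterThan, simp) (rule ennreal_leI)
      show "erlang_mean (Suc j) ?A < top"
        using b by (subst erlang_mean_times_greaterThan) auto
    qed auto
    then show ?thesis by (rule up) (auto simp: x_def)
  qed
qed

section \<open>Asymptotic ratio\<close>

text \<open>Since \<open>X r\<close> is at least of order \<open>1 / sqrt r\<close>, the additive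
  error of order \<open>1 / r\<close> is at most \<open>t r * X r\<close> with \<open>t\<close>
  tending to 0, whence \<open>(1 - t r) * X r \<le> (1 + e r) * Y r\<close>.\<close>

lemma ratio_tendsto_1:
  fixes X Y :: "nat \<Rightarrow> ennreal" and b :: real
  assumes b: "0 < b" and fin: "\<And>r. 2 \<le> r \<Longrightarrow> X r < top" and YX: "\<And>r. 2 \<le> r \<Longrightarrow> Y r \<le> X r"
    and low: "\<And>r. 2 \<le> r \<Longrightarrow> ennreal (b * exp (- 1) / sqrt (real (r - 1))) \<le> X r"
    and near: "\<And>r. 3 \<le> r \<Longrightarrow> X r \<le> ennreal (1 + 3 / real (r - 2)) * Y r + ennreal (b * (3 / real (r - 2)))"
  shows "(\<lambda>r. X r / Y r) \<longlonglongrightarrow> 1"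
proof -
  define e where "e = (\<lambda>r. 3 / real (r - 2))"
  define t where "t = (\<lambda>r. e r * exp 1 * sqrt (real (r - 1)))"
  have "(\<lambda>r. 3 / (real r - 2)) \<longlonglongrightarrow> 0" "(\<lambda>r. 3 / (real r - 2) * exp 1 * sqrt (real r - 1)) \<longlonglongrightarrow> 0"
    by real_asymp+
  moreover have "\<forall>\<^sub>F r in sequentially. 3 / (real r - 2) = e r"
    "\<forall>\<^sub>F r in sequentially. 3 / (real r - 2) * exp 1 * sqrt (real r - 1) = t r"
    unfolding e_def t_def by (intro eventually_sequentiallyI[of 2], simp add: of_nat_diff)+
  ultimately have e0: "e \<longlonglongrightarrow> 0" and t0: "t \<longlonglongrightarrow> 0"
    by (auto intro: Lim_transform_eventually)
  define q where "q = (\<lambda>r. (1 + e r) / (1 - t r))"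
  have "q \<longlonglongrightarrow> (1 + 0) / (1 - 0)" unfolding q_def using e0 t0 by (intro tendsto_intros) auto
  then have "(\<lambda>r. ennreal (q r)) \<longlonglongrightarrow> ennreal 1" by (intro tendsto_intros) simp
  then have q1: "(\<lambda>r. ennreal (q r)) \<longlonglongrightarrow> 1" by simp
  have "\<forall>\<^sub>F r in sequentially. t r < 1" using t0 by (rule order_tendstoD) simp
  moreover have "\<forall>\<^sub>F r in sequentially. 3 \<le> r" by (rule eventually_ge_at_top)
  ultimately have "\<forall>\<^sub>F r in sequentially. 1 \<le> X r / Y r \<and> X r / Y r \<le> ennreal (q r)"
  proof eventually_elim
    case (elim r)
    obtain x where x: "X r = ennreal x" "0 \<le> x" using fin[of r] elim by (cases "X r") auto
    obtain y where y: "Y r = ennreal y" "0 \<le> y" using fin[of r] YX[of r] elim by (cases "Y r") (auto simp: top_unique)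
    have yx: "y \<le> x" using YX[of r] elim x y by (simp add: ennreal_le_iff)
    have er: "0 \<le> e r" by (simp add: e_def)
    have r1: "0 < sqrt (real (r - 1))" using elim by simp
    have "b * exp (- 1) / sqrt (real (r - 1)) \<le> x" using low[of r] elim x by (simp add: ennreal_le_iff)
    then have bx: "b \<le> exp 1 * sqrt (real (r - 1)) * x"
      using r1 by (simp add: exp_minus field_simps)
    then have x0: "0 < x" using b r1 by (smt (verit) exp_gt_zero mult_nonneg_nonpos mult_pos_pos)
    have "ennreal x \<le> ennreal ((1 + e r) * y + b * e r)"
      using near[of r] elim x y b er by (simp add: e_def ennreal_mult)
    then have "x \<le> (1 + e r) * y + b * e r" using b er y by (subst (asm) ennreal_le_iff) auto
    also have "b * e r \<le> exp 1 * sqrt (real (r - 1)) * x * e r" using bx er by (intro mult_right_mono) auto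
    also have "\<dots> = t r * x" by (simp add: t_def)
    finally have m: "(1 - t r) * x \<le> (1 + e r) * y" by (simp add: algebra_simps)
    \<comment> \<open>Positivity of \<open>y\<close> makes the quotient in \<open>ennreal\<close> a
      quotient of reals.\<close>
    have "0 < (1 - t r) * x" using elim x0 by simp
    with m have "0 < (1 + e r) * y" by linarith
    then have y0: "0 < y" using er by (simp add: zero_less_mult_iff)
    have "x / y \<le> q r" unfolding q_def using m elim y0 by (simp add: field_simps)
    moreover have "1 \<le> x / y" using yx y0 by simp
    moreover have "X r / Y r = ennreal (x / y)" using x y y0 by (simp add: divide_ennreal)
    ultimately show ?case by (simp add: ennreal_leI flip: ennreal_1)
  qed
  then show ?thesis
    by (intro tendsto_sandwich[OF _ _ tendsto_const q1]) (auto elim: eventually_mono)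
qed

text \<open>The common frame of both cases: \<open>H r W\<close> is the limiting risk of the
  estimator with constant \<open>W\<close>. The limit is required where \<open>H\<close> is finite,
  because nonpositive constants have infinite mean under the second loss.\<close>

lemma minimax_ratio:
  fixes L :: "real \<Rightarrow> ennreal" and G :: "real \<Rightarrow> nat \<Rightarrow> real" and \<Omega> :: "nat \<Rightarrow> real"
  defines "H \<equiv> \<lambda>r W. erlang_mean (r - 1) (\<lambda>v. L (W / v))"
  assumes L: "continuous_on UNIV L"
    and coercive: "\<And>M::real. \<exists>X. \<forall>x. X \<le> \<bar>x\<bar> \<longrightarrow> ennreal M \<le> L x"
    and b: "0 < b"
    and lim: "\<And>r W. 2 \<le> r \<Longrightarrow> H r W < top \<Longrightarrow> (risk L r (nonrandomized (G W)) \<longlongrightarrow> H r W) (at_right 0)"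
    and le: "\<And>r p. 2 \<le> r \<Longrightarrow> p \<in> {0<..<1} \<Longrightarrow> risk L r (nonrandomized (G (\<Omega> r))) p \<le> H r (\<Omega> r)"
    and fin: "\<And>r. 2 \<le> r \<Longrightarrow> H r (\<Omega> r) < top"
    and low: "\<And>r. 2 \<le> r \<Longrightarrow> ennreal (b * exp (- 1) / sqrt (real (r - 1))) \<le> H r (\<Omega> r)"
    and near: "\<And>r W. 3 \<le> r \<Longrightarrow> H r (\<Omega> r) \<le> ennreal (1 + 3 / real (r - 2)) * H r W + ennreal (b * (3 / real (r - 2)))"
  shows "\<exists>eta_bar eta_star :: nat \<Rightarrow> ennreal.
      (\<forall>r\<ge>2.
         (risk L r (nonrandomized (G (\<Omega> r))) \<longlongrightarrow> eta_bar r) (at_right 0) \<and>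
         eta_bar r = (SUP p\<in>{0<..<1}. risk L r (nonrandomized (G (\<Omega> r))) p) \<and>
         (\<exists>K\<in>estimators. asymptotic_risk L r K = eta_star r) \<and>
         (\<forall>K\<in>estimators. eta_star r \<le> asymptotic_risk L r K)) \<and>
      (\<lambda>r. eta_bar r / eta_star r) \<longlonglongrightarrow> 1"
proof -
  have "\<exists>W. \<forall>W'. H r W \<le> H r W'" for r
    unfolding H_def using erlang_mean_attains_min[OF L coercive] by metis
  then obtain w where w: "\<And>r W'. H r (w r) \<le> H r W'" by metis
  have wfin: "H r (w r) < top" if "2 \<le> r" for r using w[of r "\<Omega> r"] fin[OF that] by (rule order.strict_trans1)
  have "eventually (\<lambda>p. p \<in> {0<..<1}) (at_right (0::real))" by (rule eventually_at_right_real) simp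
  show ?thesis
  proof (rule exI[of _ "\<lambda>r. H r (\<Omega> r)"], rule exI[of _ "\<lambda>r. H r (w r)"], intro conjI allI impI)
    fix r :: nat assume r: "2 \<le> r"
    show l: "(risk L r (nonrandomized (G (\<Omega> r))) \<longlongrightarrow> H r (\<Omega> r)) (at_right 0)"
      using r fin by (intro lim) auto
    show "H r (\<Omega> r) = (SUP p\<in>{0<..<1}. risk L r (nonrandomized (G (\<Omega> r))) p)"
    proof (rule antisym)
      show "H r (\<Omega> r) \<le> (SUP p\<in>{0<..<1}. risk L r (nonrandomized (G (\<Omega> r))) p)"
        using \<open>eventually _ _\<close>
        by (intro tendsto_upperbound[OF l]) (auto elim!: eventually_mono intro: SUP_upper)
      show "(SUP p\<in>{0<..<1}. risk L r (nonrandomized (G (\<Omega> r))) p) \<le> H r (\<Omega> r)"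
        using r by (intro SUP_least le)
    qed
    \<comment> \<open>The constant \<open>w r\<close> minimising \<open>H r\<close> gives an optimal
      estimator; the Bayes bound then covers all randomized ones.\<close>
    have "asymptotic_risk L r (nonrandomized (G (w r))) = H r (w r)"
      unfolding asymptotic_risk_def using r wfin by (intro lim_imp_Limsup lim) auto
    then show "\<exists>K\<in>estimators. asymptotic_risk L r K = H r (w r)"
      using nonrandomized_in_estimators by blast
    show "\<forall>K\<in>estimators. H r (w r) \<le> asymptotic_risk L r K"
    proof
      fix K :: "nat \<Rightarrow> real measure" assume "K \<in> estimators"
      then obtain W where "erlang_mean (r - 1) (\<lambda>v. L (W / v)) \<le> asymptotic_risk L (Suc (r - 1)) K"
        using asymptotic_risk_ge_erlang_mean[OF L coercive] by blast
      then show "H r (w r) \<le> asymptotic_risk L r K"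
        using w[of r W] r by (simp add: H_def)
    qed
  next
    show "(\<lambda>r. H r (\<Omega> r) / H r (w r)) \<longlonglongrightarrow> 1"
      using b fin w low near by (rule ratio_tendsto_1)
  qed
qed

section \<open>The two estimators\<close>

lemma linear_minimax_ratio:
  assumes b: "0 < b"
  shows "\<exists>eta_bar eta_star :: nat \<Rightarrow> ennreal.
      (\<forall>r\<ge>2.
         (risk (loss_linear b b) r (nonrandomized (\<lambda>n. (real r - 1) / (real n - 1))) \<longlongrightarrow> eta_bar r) (at_right 0) \<and>
         eta_bar r = (SUP p\<in>{0<..<1}. risk (loss_linear b b) r (nonrandomized (\<lambda>n. (real r - 1) / (real n - 1))) p) \<and>
         (\<exists>K\<in>estimators. asymptotic_risk (loss_linear b b) r K = eta_star r) \<and>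
         (\<forall>K\<in>estimators. eta_star r \<le> asymptotic_risk (loss_linear b b) r K)) \<and>
      (\<lambda>r. eta_bar r / eta_star r) \<longlonglongrightarrow> 1"
proof (rule minimax_ratio[where G="\<lambda>W n. W / (real n - 1)" and \<Omega>="\<lambda>r. real r - 1", OF
      continuous_loss_linear coercive_loss_linear[OF b] b])
  fix r :: nat
  assume "2 \<le> r"
  define k where "k = r - 2"
  have r: "r = Suc (Suc k)" using \<open>2 \<le> r\<close> by (simp add: k_def)
  show "(risk (loss_linear b b) r (nonrandomized (\<lambda>n. W / (real n - 1))) \<longlongrightarrow>
      erlang_mean (r - 1) (\<lambda>v. loss_linear b b (W / v))) (at_right 0)" for W
    unfolding r using linear_estimator_risk(1)[OF b] by simp
  show "risk (loss_linear b b) r (nonrandomized (\<lambda>n. (real r - 1) / (real n - 1))) p \<le>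
      erlang_mean (r - 1) (\<lambda>v. loss_linear b b ((real r - 1) / v))" if "p \<in> {0<..<1}" for p
    unfolding r using linear_estimator_risk(2)[OF b that] by simp
  \<comment> \<open>Lowering the shape from \<open>r\<close> to \<open>r - 1\<close> brings in the
    division by \<open>Suc k\<close>, which is \<open>r - 1\<close>.\<close>
  define c where "c = b / real (Suc k)"
  have c: "0 < c" using b by (simp add: c_def)
  have H: "erlang_mean (r - 1) (\<lambda>v. loss_linear b b (W / v)) = erlang_mean k (\<lambda>v. ennreal (c * \<bar>W - v\<bar>))" for W
    unfolding r c_def using erlang_mean_linear_eq[of k b W] by simp
  have r1: "real r - 1 = real (Suc k)" by (simp add: r)
  have "erlang_mean k (\<lambda>v. ennreal (c * \<bar>real (Suc k) - v\<bar>)) \<le>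
    erlang_mean k (\<lambda>v. ennreal (c * real (Suc k)) + ennreal (c * v) * 1)"
  proof (intro erlang_mean_mono)
    fix v :: real assume v: "0 < v"
    have "c * \<bar>real (Suc k) - v\<bar> \<le> c * (real (Suc k) + v)" using c v by (intro mult_left_mono) auto
    then show "ennreal (c * \<bar>real (Suc k) - v\<bar>) \<le> ennreal (c * real (Suc k)) + ennreal (c * v) * 1"
      using c v by (simp add: distrib_left ennreal_leI flip: ennreal_plus)
  qed
  also have "\<dots> < top"
    using c by (subst erlang_mean_add, simp, simp, subst erlang_mean_times)
      (auto simp: erlang_mean_const)
  finally show "erlang_mean (r - 1) (\<lambda>v. loss_linear b b ((real r - 1) / v)) < top" unfolding H r1 .
  \<comment> \<open>Only the part below the mean is kept, where the loss is the deficit.\<close>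
  have "ennreal c * ennreal (exp (- 1) * sqrt (real (Suc k))) \<le>
    ennreal c * erlang_mean k (\<lambda>v. ennreal (real (Suc k) - v) * indicator {..real (Suc k)} v)"
    by (intro mult_left_mono erlang_mean_deficit) simp
  also have "\<dots> \<le> erlang_mean k (\<lambda>v. ennreal (c * \<bar>real (Suc k) - v\<bar>))"
    using c by (subst erlang_mean_cmult[symmetric], simp, intro erlang_mean_mono)
      (auto split: split_indicator simp: ennreal_mult[symmetric] intro!: ennreal_leI)
  also have "ennreal c * ennreal (exp (- 1) * sqrt (real (Suc k))) = ennreal (b * exp (- 1) / sqrt (real (r - 1)))"
    using c by (simp add: r c_def real_div_sqrt mult.commute flip: ennreal_mult) (simp add: field_simps)
  finally show "ennreal (b * exp (- 1) / sqrt (real (r - 1))) \<le> erlang_mean (r - 1) (\<lambda>v. loss_linear b b ((real r - 1) / v))"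
    unfolding H r1 .
next
  fix r :: nat and W :: real
  assume "3 \<le> r"
  define k where "k = r - 2"
  have r: "r = Suc (Suc k)" "1 \<le> k" using \<open>3 \<le> r\<close> by (simp_all add: k_def)
  define c where "c = b / real (Suc k)"
  have c: "0 < c" using b by (simp add: c_def)
  have H: "erlang_mean (r - 1) (\<lambda>v. loss_linear b b (W / v)) = erlang_mean k (\<lambda>v. ennreal (c * \<bar>W - v\<bar>))" for W
    unfolding r c_def using erlang_mean_linear_eq[of k b W] by simp
  have r1: "real r - 1 = real (Suc k)" by (simp add: r)
  have "c \<le> b * (3 / real k)"
    using b r by (simp add: c_def field_simps)
  moreover have "1 * erlang_mean k (\<lambda>v. ennreal (c * \<bar>W - v\<bar>)) \<le> ennreal (1 + 3 / real k) * erlang_mean k (\<lambda>v. ennreal (c * \<bar>W - v\<bar>))"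
    by (intro mult_right_mono) (auto simp flip: ennreal_1 intro!: ennreal_leI)
  ultimately have "erlang_mean k (\<lambda>v. ennreal (c * \<bar>real (Suc k) - v\<bar>)) \<le> ennreal (1 + 3 / real k) * erlang_mean k (\<lambda>v. ennreal (c * \<bar>W - v\<bar>)) + ennreal (b * (3 / real k))"
    using erlang_mean_abs_le[of c k W] c by (auto intro: order_trans add_mono ennreal_leI)
  then show "erlang_mean (r - 1) (\<lambda>v. loss_linear b b ((real r - 1) / v)) \<le>
    ennreal (1 + 3 / real (r - 2)) * erlang_mean (r - 1) (\<lambda>v. loss_linear b b (W / v)) + ennreal (b * (3 / real (r - 2)))"
    unfolding H r1 by (simp add: k_def)
qed

lemma inverse_linear_minimax_ratio:
  assumes b: "0 < b"
  shows "\<exists>eta_bar eta_star :: nat \<Rightarrow> ennreal.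
      (\<forall>r\<ge>2.
         (risk (loss_inverse_linear b b) r (nonrandomized (\<lambda>n. sqrt (real r * (real r - 1)) / real n)) \<longlongrightarrow> eta_bar r) (at_right 0) \<and>
         eta_bar r = (SUP p\<in>{0<..<1}. risk (loss_inverse_linear b b) r (nonrandomized (\<lambda>n. sqrt (real r * (real r - 1)) / real n)) p) \<and>
         (\<exists>K\<in>estimators. asymptotic_risk (loss_inverse_linear b b) r K = eta_star r) \<and>
         (\<forall>K\<in>estimators. eta_star r \<le> asymptotic_risk (loss_inverse_linear b b) r K)) \<and>
      (\<lambda>r. eta_bar r / eta_star r) \<longlonglongrightarrow> 1"
proof (rule minimax_ratio[where G="\<lambda>W n. W / real n" and \<Omega>="\<lambda>r. sqrt (real r * (real r - 1))", OF
      continuous_loss_inverse_linear[OF b] coercive_loss_inverse_linear[OF b] b])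
  \<comment> \<open>Nonpositive constants give nonpositive estimates, whose loss is
    infinite.\<close>
  have H0: "erlang_mean k (\<lambda>v. loss_inverse_linear b b (W / v)) = top" if "W \<le> 0" for k W
  proof -
    have "erlang_mean k (\<lambda>v. top) \<le> erlang_mean k (\<lambda>v. loss_inverse_linear b b (W / v))"
      using that by (intro erlang_mean_mono) (auto simp: loss_inverse_linear_def divide_nonpos_pos)
    then show ?thesis by (simp add: erlang_mean_const top_unique)
  qed
  have H: "erlang_mean k (\<lambda>v. loss_inverse_linear b b (W / v)) = erlang_mean k (\<lambda>v. ennreal (b * (max (W / v) (v / W) - 1)))"
    if "0 < W" for k W
    using that by (intro antisym erlang_mean_mono) (auto simp: loss_inverse_linear_eq)
  \<comment> \<open>The geometric mean of \<open>r - 1\<close> and \<open>r\<close> lies between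
    them; with \<open>j = r - 2\<close> this is the interval required of \<open>W'\<close> in
    \<open>erlang_mean_max_le\<close>.\<close>
  have \<Omega>: "real r - 1 \<le> sqrt (real r * (real r - 1))" "sqrt (real r * (real r - 1)) \<le> real r"
    "0 < sqrt (real r * (real r - 1))" if "2 \<le> r" for r :: nat
  proof -
    have "(real r - 1) * (real r - 1) \<le> real r * (real r - 1)" "real r * (real r - 1) \<le> real r * real r"
      using that by (intro mult_right_mono mult_left_mono; simp)+
    then show "real r - 1 \<le> sqrt (real r * (real r - 1))" "sqrt (real r * (real r - 1)) \<le> real r"
      using that by (auto intro!: real_le_rsqrt real_le_lsqrt simp: power2_eq_square)
    show "0 < sqrt (real r * (real r - 1))" using that by simp
  qed
  {
    fix r :: nat
    assume r2: "2 \<le> r"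
    define k where "k = r - 2"
    have r: "r = Suc (Suc k)" using r2 by (simp add: k_def)
    have r1: "real r - 1 = real (Suc k)" by (simp add: r)
    let ?W = "sqrt (real r * (real r - 1))"
    note W = \<Omega>[OF r2]
    show "(risk (loss_inverse_linear b b) r (nonrandomized (\<lambda>n. x / real n)) \<longlongrightarrow>
        erlang_mean (r - 1) (\<lambda>v. loss_inverse_linear b b (x / v))) (at_right 0)"
      if "erlang_mean (r - 1) (\<lambda>v. loss_inverse_linear b b (x / v)) < top" for x
    proof -
      have "0 < x" using that H0[of x] by (cases "0 < x") auto
      then show ?thesis unfolding r using inverse_linear_estimator_risk(1)[OF b, of x "Suc k"] by simp
    qed
    show "risk (loss_inverse_linear b b) r (nonrandomized (\<lambda>n. ?W / real n)) p \<le>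
        erlang_mean (r - 1) (\<lambda>v. loss_inverse_linear b b (?W / v))" if "p \<in> {0<..<1}" for p
      using inverse_linear_estimator_risk(2)[OF b W(3) that, of "r - 1"] r2 by simp
    have "erlang_mean (Suc k) (\<lambda>v. ennreal (b * (max (?W / v) (v / ?W) - 1))) \<le>
      erlang_mean (Suc k) (\<lambda>v. ennreal (b * ?W / v) * 1 + ennreal (b / ?W * v) * 1)"
    proof (intro erlang_mean_mono)
      fix v :: real assume v: "0 < v"
      have "max (?W / v) (v / ?W) - 1 \<le> ?W / v + v / ?W"
        using v W(3) by (smt (verit) divide_pos_pos)
      then have "b * (max (?W / v) (v / ?W) - 1) \<le> b * (?W / v + v / ?W)" using b by (intro mult_left_mono) auto
      also have "\<dots> = b * ?W / v + b / ?W * v" by (simp add: distrib_left)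
      finally have "ennreal (b * (max (?W / v) (v / ?W) - 1)) \<le> ennreal (b * ?W / v + b / ?W * v)" by (rule ennreal_leI)
      also have "\<dots> = ennreal (b * ?W / v) + ennreal (b / ?W * v)"
        using b v W(3) by (intro ennreal_plus) (auto intro!: divide_nonneg_nonneg mult_nonneg_nonneg)
      finally show "ennreal (b * (max (?W / v) (v / ?W) - 1)) \<le> ennreal (b * ?W / v) * 1 + ennreal (b / ?W * v) * 1"
        by (simp only: mult_1_right)
    qed
    also have "\<dots> < top"
      using b W(3) by (subst erlang_mean_add, measurable, subst erlang_mean_times, simp, simp, subst erlang_mean_divide)
        (auto simp: erlang_mean_const)
    finally show "erlang_mean (r - 1) (\<lambda>v. loss_inverse_linear b b (?W / v)) < top"
      unfolding H[OF W(3)] by (simp add: r)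
    have "ennreal (b * exp (- 1) / sqrt (real (r - 1))) = ennreal (b / real (Suc k)) * ennreal (exp (- 1) * sqrt (real (Suc k)))"
      using b by (simp add: r real_div_sqrt flip: ennreal_mult) (simp add: field_simps)
    \<comment> \<open>For \<open>v \<le> r - 1\<close> the loss is at least
      \<open>b * (r - 1 - v) / v\<close>; the factor \<open>1 / v\<close> lowers the shape by one
      and leaves the deficit already estimated.\<close>
    also have "\<dots> \<le> ennreal (b / real (Suc k)) * erlang_mean k (\<lambda>v. ennreal (real (Suc k) - v) * indicator {..real (Suc k)} v)"
      by (intro mult_left_mono erlang_mean_deficit) simp
    also have "\<dots> = erlang_mean (Suc k) (\<lambda>v. ennreal (b / v) * (ennreal (real (Suc k) - v) * indicator {..real (Suc k)} v))"
      using b by (subst erlang_mean_divide) auto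
    also have "\<dots> \<le> erlang_mean (Suc k) (\<lambda>v. ennreal (b * (max (?W / v) (v / ?W) - 1)))"
    proof (intro erlang_mean_mono)
      fix v :: real assume v: "0 < v"
      show "ennreal (b / v) * (ennreal (real (Suc k) - v) * indicator {..real (Suc k)} v) \<le> ennreal (b * (max (?W / v) (v / ?W) - 1))"
      proof (cases "v \<le> real (Suc k)")
        case True
        have "real (Suc k) / v \<le> ?W / v" using W(1) v unfolding r1 by (intro divide_right_mono) auto
        then have "b * (real (Suc k) / v - 1) \<le> b * (max (?W / v) (v / ?W) - 1)"
          using b by (intro mult_left_mono) auto
        moreover have "b / v * (real (Suc k) - v) = b * (real (Suc k) / v - 1)" using v by (simp add: field_simps)
        ultimately have "b / v * (real (Suc k) - v) \<le> b * (max (?W / v) (v / ?W) - 1)" by (simp only:)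
        then have "ennreal (b / v * (real (Suc k) - v)) \<le> ennreal (b * (max (?W / v) (v / ?W) - 1))" by (rule ennreal_leI)
        moreover have "ennreal (b / v * (real (Suc k) - v)) = ennreal (b / v) * ennreal (real (Suc k) - v)"
          using True b v by (intro ennreal_mult) auto
        moreover have "indicator {..real (Suc k)} v = (1 :: ennreal)" using True by simp
        ultimately show ?thesis by (simp only: mult_1_right)
      qed simp
    qed
    finally show "ennreal (b * exp (- 1) / sqrt (real (r - 1))) \<le> erlang_mean (r - 1) (\<lambda>v. loss_inverse_linear b b (?W / v))"
      unfolding H[OF W(3)] by (simp add: r)
  }
  fix r :: nat and x :: real
  assume r3: "3 \<le> r"
  define j where "j = r - 2"
  have r: "r = Suc (Suc j)" "1 \<le> j" using r3 by (simp_all add: j_def)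
  let ?W = "sqrt (real r * (real r - 1))"
  have W: "real (j + 1) \<le> ?W" "?W \<le> real (j + 2)" "0 < ?W" using \<Omega>[of r] r by auto
  show "erlang_mean (r - 1) (\<lambda>v. loss_inverse_linear b b (?W / v)) \<le>
    ennreal (1 + 3 / real (r - 2)) * erlang_mean (r - 1) (\<lambda>v. loss_inverse_linear b b (x / v)) + ennreal (b * (3 / real (r - 2)))"
  proof (cases "0 < x")
    case True
    then show ?thesis
      using erlang_mean_max_le[OF b r(2) True W(1,2)] unfolding H[OF True] H[OF W(3)] j_def[symmetric]
      by (simp add: r)
  next
    case False
    then show ?thesis by (simp add: H0 ennreal_mult_top add_pos_nonneg)
  qed
qed

theorem proposition3:
  fixes a b :: real
  assumes "a = b" and "b > 0"
  shows "\<forall>(L, g) \<in> {(loss_linear a b, \<lambda>r n. (real r - 1) / (real n - 1)),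
                     (loss_inverse_linear a b, \<lambda>r n. sqrt (real r * (real r - 1)) / real n)}.
    \<exists>eta_bar eta_star :: nat \<Rightarrow> ennreal.
      (\<forall>r\<ge>2.
         (risk L r (nonrandomized (g r)) \<longlongrightarrow> eta_bar r) (at_right 0) \<and>
         eta_bar r = (SUP p\<in>{0<..<1}. risk L r (nonrandomized (g r)) p) \<and>
         (\<exists>K\<in>estimators. asymptotic_risk L r K = eta_star r) \<and>
         (\<forall>K\<in>estimators. eta_star r \<le> asymptotic_risk L r K)) \<and>
      (\<lambda>r. eta_bar r / eta_star r) \<longlonglongrightarrow> 1" (is "\<forall>(L, g) \<in> _. ?P L g")
  unfolding assms(1)
proof (rule ballI, elim insertE emptyE)
  fix Lg :: "(real \<Rightarrow> ennreal) \<times> (nat \<Rightarrow> nat \<Rightarrow> real)"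
  show "case Lg of (L, g) \<Rightarrow> ?P L g" if "Lg = (loss_linear b b, \<lambda>r n. (real r - 1) / (real n - 1))"
    unfolding that prod.case by (rule linear_minimax_ratio[OF assms(2)])
  show "case Lg of (L, g) \<Rightarrow> ?P L g" if "Lg = (loss_inverse_linear b b, \<lambda>r n. sqrt (real r * (real r - 1)) / real n)"
    unfolding that prod.case by (rule inverse_linear_minimax_ratio[OF assms(2)])
qed

end
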